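(* Let $1\le\beta\le\infty$, and let $\varphi:\mathbb R\to[0,\infty]$ be proper, lower semicontinuous, even and convex, with $\varphi(0)=0$. Assume that $V_\beta(\varphi)$ and $V_\beta(\mathcal L\varphi)$ are positive and finite. Then $$V_\beta(\varphi)\,V_\beta(\mathcal L\varphi)\le V_\beta(q)^2,\qquad q(x)=\frac{x^2}{2}.$$ For $1\le\beta<\infty$, $$V_\beta(q)^2=2\beta\pi\left(\frac{\Gamma(\beta+\frac12)}{\Gamma(\beta+1)}\right)^2,$$ while $V_\infty(q)^2=2\pi$. Equality holds in the inequality if and only if $\varphi(x)=\frac{cx^2}{2}$ for some $c>0$.
   Context: $\mathcal L\varphi(y)=\sup_{x\in\mathbb R}(xy-\varphi(x))$ is the Legendre transform. For $1\le\beta<\infty$, $V_\beta(\varphi)=\int_{\mathbb R}\left(1+\frac{\varphi(x)}{\beta}\right)^{-\beta-1}dx$, and $V_\infty(\varphi)=\int_{\mathbb R}e^{-\varphi(x)}\,dx$ (integrands are $0$ where $\varphi=+\infty$). *)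

theory Defs
  imports "HOL-Analysis.Analysis"
begin

definition proper_fun :: "(real \<Rightarrow> ereal) \<Rightarrow> bool" where
  "proper_fun \<phi> \<longleftrightarrow> (\<forall>x. \<phi> x \<noteq> -\<infinity>) \<and> (\<exists>x. \<phi> x \<noteq> \<infinity>)"

definition lower_semicont :: "(real \<Rightarrow> ereal) \<Rightarrow> bool" where
  "lower_semicont \<phi> \<longleftrightarrow> (\<forall>a. closed {x. \<phi> x \<le> a})"

definition even_fun :: "(real \<Rightarrow> ereal) \<Rightarrow> bool" where
  "even_fun \<phi> \<longleftrightarrow> (\<forall>x. \<phi> (- x) = \<phi> x)"

text \<open>Meant for functions that do not take the value \<open>-\<infinity>\<close>; at the endpoints
  \<open>u = 0\<close> and \<open>v = 0\<close> the convention \<open>0 * \<infinity> = 0\<close> of \<^typ>\<open>ereal\<close> makes the condition trivial.\<close>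

definition convex_fun :: "(real \<Rightarrow> ereal) \<Rightarrow> bool" where
  "convex_fun \<phi> \<longleftrightarrow>
    (\<forall>x y u v. 0 \<le> u \<longrightarrow> 0 \<le> v \<longrightarrow> u + v = 1 \<longrightarrow>
       \<phi> (u * x + v * y) \<le> ereal u * \<phi> x + ereal v * \<phi> y)"

definition legendre :: "(real \<Rightarrow> ereal) \<Rightarrow> real \<Rightarrow> ereal" where
  "legendre \<phi> y = (SUP x. ereal (x * y) - \<phi> x)"

text \<open>Only \<open>1 \<le> \<beta> \<le> \<infinity>\<close> and \<open>0 \<le> t \<le> \<infinity>\<close> are meaningful.\<close>

definition weight :: "ereal \<Rightarrow> ereal \<Rightarrow> real" where
  "weight \<beta> t =
    (if t = \<infinity> then 0
     else if \<beta> = \<infinity> then exp (- real_of_ereal t)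
     else (1 + real_of_ereal t / real_of_ereal \<beta>) powr (- real_of_ereal \<beta> - 1))"

definition V :: "ereal \<Rightarrow> (real \<Rightarrow> ereal) \<Rightarrow> ennreal" where
  "V \<beta> \<phi> = (\<integral>\<^sup>+ x. ennreal (weight \<beta> (\<phi> x)) \<partial>lborel)"

definition q :: "real \<Rightarrow> ereal" where
  "q x = ereal (x\<^sup>2 / 2)"

end

theory Submission
  imports Defs "HOL-Probability.Distribution_Functions" "HOL-Probability.Distributions"
begin

text \<open>
  Let \<open>X a\<close> and \<open>Y a\<close> be the half-lengths of the sublevel sets of \<open>\<phi>\<close> and of its Legendre transform
  at level \<open>a\<close>. By the layer-cake formula each volume is the integral of the half-lengths against a
  density that depends on \<open>\<beta>\<close> alone, and Young's inequality gives \<open>X a * Y b \<le> a + b\<close>. For \<open>q\<close> the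
  half-length is \<open>sqrt (2 * a)\<close>, and there \<open>X a * Y a = 2 * a\<close>. So the inequality is of
  Prekopa-Leindler type: a bound for products at two different levels is to be turned into a bound
  for a product of integrals by the square of the integral of an intermediate function.

  The Prekopa-Leindler inequality compares values at \<open>\<alpha>\<close> and \<open>\<gamma>\<close> with the value at
  \<open>(\<alpha> + \<gamma>) / 2\<close>, so everything hinges on the coordinate in which levels are averaged. If
  \<open>\<beta> = \<infinity>\<close> the level itself will do: the density is \<open>exp (- a)\<close>, and
  \<open>(a + b) * exp (- a) * exp (- b)\<close> depends on \<open>a + b\<close> only. For finite \<open>\<beta>\<close> the right coordinate
  is the angle in \<open>a = \<beta> * (tan \<alpha>)\<^sup>2\<close> (\<open>level_parametrization_finite\<close>). The required
  inequality then splits into the identity \<open>(P + Q) ^ 4 - 8 * P * Q * (P\<^sup>2 + Q\<^sup>2) = (P - Q) ^ 4\<close> for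
  \<open>P = sin \<alpha> * cos \<gamma>\<close>, \<open>Q = cos \<alpha> * sin \<gamma>\<close> and the log-concavity of a power of the cosine, whose
  exponent is nonnegative because \<open>\<beta> \<ge> 1\<close> (\<open>trig_mean_inequality\<close>).

  In one dimension the Prekopa-Leindler inequality follows by transporting the two densities
  simultaneously, and its equality case can be read off (\<open>prekopa_leindler_interval\<close>): the half-lengths
  are proportional and \<open>X a * Y a = 2 * a\<close> at every level. Hence \<open>X a\<close> is a multiple of \<open>sqrt a\<close>,
  which means that \<open>\<phi>\<close> is a quadratic (\<open>santalo_inequality\<close>). Conversely all quadratics give the
  same product by scaling, and the volume of \<open>q\<close> is computed from Gaussian and Gamma integrals.
\<close>

section \<open>The Prekopa-Leindler inequality on an interval, with its equality case\<close>

locale interval_density =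
  fixes S :: "real set" and F :: "real \<Rightarrow> real"
  assumes open_S: "open S"
    and interval_S: "is_interval S"
    and nonempty_S: "S \<noteq> {}"
    and cont: "continuous_on S F"
    and pos: "\<And>x. x \<in> S \<Longrightarrow> 0 < F x"
    and zero_outside: "\<And>x. x \<notin> S \<Longrightarrow> F x = 0"
    and integrable_F: "integrable lborel F"
begin

abbreviation mass :: real where "mass \<equiv> integral\<^sup>L lborel F"

definition cumul :: "real \<Rightarrow> real" where "cumul = cdf (density lborel F)"

lemma nonneg: "0 \<le> F x"
  by (cases "x \<in> S") (auto simp: zero_outside intro: less_imp_le pos)

lemma measurable_F [measurable]: "F \<in> borel_measurable borel"
  using borel_measurable_integrable[OF integrable_F] by simp

lemma mem_between: "a \<in> S \<Longrightarrow> b \<in> S \<Longrightarrow> a \<le> x \<Longrightarrow> x \<le> b \<Longrightarrow> x \<in> S"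
  using interval_S mem_is_interval_1_I by blast

lemma set_integrable_F: "A \<in> sets borel \<Longrightarrow> set_integrable lborel A F"
  unfolding set_integrable_def
  using integrable_mult_indicator[OF _ integrable_F, of A] by simp

lemma emeasure_density_F:
  assumes "A \<in> sets borel"
  shows "emeasure (density lborel F) A = ennreal (LINT x:A|lborel. F x)"
proof -
  have "emeasure (density lborel F) A = (\<integral>\<^sup>+ x. ennreal (indicator A x *\<^sub>R F x) \<partial>lborel)"
    using assms by (subst emeasure_density) (auto intro!: nn_integral_cong simp: indicator_def)
  also have "\<dots> = ennreal (LINT x:A|lborel. F x)"
    unfolding set_lebesgue_integral_def
    using set_integrable_F[OF assms] nonneg
    by (intro nn_integral_eq_integral) (auto simp: set_integrable_def)
  finally show ?thesis .
qed

lemma measure_density_F: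
  assumes "A \<in> sets borel"
  shows "measure (density lborel F) A = (LINT x:A|lborel. F x)"
proof -
  have "0 \<le> (LINT x:A|lborel. F x)"
    using nonneg by (auto simp: set_lebesgue_integral_def intro!: integral_nonneg_AE)
  then show ?thesis
    using emeasure_density_F[OF assms] by (simp add: measure_def)
qed

lemma measure_UNIV: "measure (density lborel F) UNIV = mass"
  by (simp add: measure_density_F set_lebesgue_integral_def)

sublocale M: finite_borel_measure "density lborel F"
proof (intro finite_borel_measure.intro finite_borel_measure_axioms.intro finite_measureI)
  show "emeasure (density lborel F) (space (density lborel F)) \<noteq> \<infinity>"
    using emeasure_density_F[of UNIV] by simp
qed simp

lemma cumul_nonneg: "0 \<le> cumul x"
  by (simp add: cumul_def M.cdf_nonneg)

lemma cumul_le_mass: "cumul x \<le> mass"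
  using M.cdf_bounded[of x] measure_UNIV by (simp add: cumul_def)

lemma cumul_mono: "x \<le> y \<Longrightarrow> cumul x \<le> cumul y"
  by (simp add: cumul_def M.cdf_nondecreasing)

lemma cumul_diff:
  assumes "a \<le> b"
  shows "cumul b - cumul a = integral {a..b} F"
proof (cases "a = b")
  case True
  then show ?thesis by simp
next
  case False
  with assms have "cumul b - cumul a = (LINT x:{a<..b}|lborel. F x)"
    by (simp add: cumul_def M.cdf_diff_eq measure_density_F)
  also have "\<dots> = integral {a<..b} F"
    by (intro set_borel_integral_eq_integral set_integrable_F) simp
  also have "\<dots> = integral {a..b} F"
    by (rule integral_spike_set) (auto intro: negligible_subset[of "{a}"])
  finally show ?thesis .
qed

lemma cumul_deriv:
  assumes "x \<in> S"
  shows "(cumul has_real_derivative F x) (at x)"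
proof -
  obtain e where e: "e > 0" "cball x e \<subseteq> S"
    using open_S assms open_contains_cball by blast
  then have sub: "{x - e..x + e} \<subseteq> S"
    by (auto simp: cball_eq_atLeastAtMost)
  then have "((\<lambda>t. integral {x - e..t} F) has_real_derivative F x) (at x within {x - e..x + e})"
    using e by (intro integral_has_real_derivative continuous_on_subset[OF cont]) auto
  then have "((\<lambda>t. cumul (x - e) + integral {x - e..t} F) has_real_derivative F x)
               (at x within {x - e..x + e})"
    by (auto intro!: derivative_eq_intros)
  then have "(cumul has_real_derivative F x) (at x within {x - e..x + e})"
    by (rule has_field_derivative_transform_within[where d = 1])
       (use e in \<open>auto simp flip: cumul_diff\<close>)
  then show ?thesis
    using e by (simp add: at_within_Icc_at)
qed

lemma cumul_isCont: "isCont cumul x"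
proof -
  have "emeasure (density lborel F) {x} = 0"
    by (simp add: emeasure_density nn_integral_indicator_singleton)
  then have "measure (density lborel F) {x} = 0"
    by (simp add: measure_def)
  then show ?thesis
    by (simp add: cumul_def M.isCont_cdf)
qed

lemma cumul_strict_mono:
  assumes "a \<in> S" "b \<in> S" "a < b"
  shows "cumul a < cumul b"
proof (rule DERIV_pos_imp_increasing[OF assms(3)])
  fix x assume "a \<le> x" "x \<le> b"
  then have "x \<in> S" using mem_between assms by blast
  then show "\<exists>y. (cumul has_real_derivative y) (at x) \<and> y > 0"
    using cumul_deriv pos by blast
qed

text \<open>Whatever the shape of \<open>S\<close>, a point at which the cumulative mass lies strictly between \<open>0\<close>
  and the total mass is therefore in \<open>S\<close>.\<close>

lemma cumul_constant_outside:
  assumes "x \<notin> S"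
  shows "cumul x = 0 \<or> cumul x = mass"
proof -
  obtain s where s: "s \<in> S" using nonempty_S by blast
  show ?thesis
  proof (cases "x < s")
    case True
    have "F y = 0" if "y \<le> x" for y
      using that assms s True mem_between[of y s x] zero_outside by force
    then have "(\<lambda>y. indicator {..x} y *\<^sub>R F y) = (\<lambda>_. 0)"
      by (auto simp: indicator_def)
    then show ?thesis
      by (simp add: cumul_def cdf_def measure_density_F set_lebesgue_integral_def)
  next
    case False
    have "F y = 0" if "y \<ge> x" for y
      using that assms s False mem_between[of s y x] zero_outside by force
    then have "(\<lambda>y. indicator {..x} y *\<^sub>R F y) = F"
      by (intro ext) (metis atMost_iff indicator_simps linorder_linear mult.left_neutral
          mult_zero_right real_scaleR_def)
    then show ?thesis
      by (simp add: cumul_def cdf_def measure_density_F set_lebesgue_integral_def)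
  qed
qed

lemma cumul_strictly_between:
  assumes "x \<in> S"
  shows "0 < cumul x" "cumul x < mass"
proof -
  obtain e where e: "e > 0" "cball x e \<subseteq> S"
    using open_S assms open_contains_cball by blast
  then have "x - e \<in> S" "x + e \<in> S"
    by (auto simp: cball_eq_atLeastAtMost)
  with assms e have "cumul (x - e) < cumul x" "cumul x < cumul (x + e)"
    by (auto intro: cumul_strict_mono)
  then show "0 < cumul x" "cumul x < mass"
    using cumul_nonneg[of "x - e"] cumul_le_mass[of "x + e"] by linarith+
qed

lemma mass_pos: "0 < mass"
  using nonempty_S cumul_strictly_between by (meson ex_in_conv less_trans)

lemma quantile_exists:
  assumes "0 < u" "u < 1"
  shows "\<exists>x\<in>S. cumul x = u * mass"
proof -
  have um: "0 < u * mass" "u * mass < mass"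
    using assms mass_pos by auto
  have "eventually (\<lambda>x. cumul x < u * mass) at_bot"
    using M.cdf_lim_at_bot um(1) by (auto simp: cumul_def intro: order_tendstoD)
  then obtain a where a: "cumul a < u * mass"
    by (auto simp: eventually_at_bot_linorder)
  have "(cumul \<longlongrightarrow> mass) at_top"
    using M.cdf_lim_at_top measure_UNIV by (simp add: cumul_def)
  then have "eventually (\<lambda>x. u * mass < cumul x) at_top"
    using um(2) by (auto intro: order_tendstoD)
  then obtain b where b: "u * mass < cumul b"
    by (auto simp: eventually_at_top_linorder)
  have "a \<le> b"
    using a b cumul_mono[of b a] by linarith
  then obtain x where "cumul x = u * mass"
    using IVT[of cumul a "u * mass" b] a b cumul_isCont by auto
  then show ?thesis
    using cumul_constant_outside[of x] um by fastforce
qed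

text \<open>Measuring the cumulative mass as a fraction of the total lets two densities of different
  total mass be run through simultaneously, by the same parameter \<open>u\<close> between \<open>0\<close> and \<open>1\<close>.\<close>

definition quantile :: "real \<Rightarrow> real" where
  "quantile u = (SOME x. x \<in> S \<and> cumul x = u * mass)"

lemma quantile:
  assumes "0 < u" "u < 1"
  shows "quantile u \<in> S" "cumul (quantile u) = u * mass"
  using someI_ex[of "\<lambda>x. x \<in> S \<and> cumul x = u * mass"] quantile_exists[OF assms]
  unfolding quantile_def by blast+

lemma cumul_fraction:
  assumes "x \<in> S"
  shows "0 < cumul x / mass" "cumul x / mass < 1"
  using cumul_strictly_between[OF assms] mass_pos by simp_all

lemma quantile_cumul:
  assumes "x \<in> S"
  shows "quantile (cumul x / mass) = x"
proof -
  note u = cumul_fraction[OF assms]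
  have "cumul (quantile (cumul x / mass)) = cumul x"
    using quantile(2)[OF u] mass_pos by simp
  then show ?thesis
    using cumul_strict_mono quantile(1)[OF u] assms by (metis linorder_neqE_linordered_idom order_less_irrefl)
qed

lemma quantile_deriv:
  assumes "0 < u" "u < 1"
  shows "(quantile has_real_derivative mass / F (quantile u)) (at u)"
proof -
  define x where "x = quantile u"
  have x: "x \<in> S" and ux: "u = cumul x / mass"
    using quantile[OF assms] mass_pos by (auto simp: x_def)
  obtain e where e: "e > 0" "cball x e \<subseteq> S"
    using open_S x open_contains_cball by blast
  then have sub: "{x - e..x + e} \<subseteq> S"
    by (auto simp: cball_eq_atLeastAtMost)
  have "isCont quantile (cumul x / mass)"
    by (rule isCont_inverse_function2[of "x - e" x "x + e" quantile "\<lambda>y. cumul y / mass"])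
       (use e sub mass_pos cumul_isCont in \<open>auto intro!: quantile_cumul continuous_intros\<close>)
  then have "isCont quantile u"
    using ux by simp
  moreover have "((\<lambda>y. cumul y / mass) has_real_derivative F x / mass) (at (quantile u))"
    using cumul_deriv[OF x] mass_pos by (auto intro!: derivative_eq_intros simp: x_def)
  ultimately have "(quantile has_real_derivative inverse (F x / mass)) (at u)"
    using assms pos[OF x] mass_pos
    by (intro DERIV_inverse_function[where a = 0 and b = 1]) (auto simp: quantile)
  then show ?thesis
    by (simp add: x_def)
qed

end

text \<open>Let \<open>x\<close>, \<open>y\<close> be the quantile functions of \<open>F\<close> and \<open>G\<close>, and \<open>m = (x + y) / 2\<close>. They
  move at the speeds \<open>p = I / F x\<close> and \<open>r = J / G y\<close>, so the mass of \<open>H\<close> to the left of \<open>m\<close> grows at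
  the rate \<open>H m * (p + r) / 2\<close>, which by the arithmetic-geometric mean inequality and the
  hypothesis is at least \<open>sqrt (F x * G y) * sqrt (p * r) = sqrt (I * J)\<close>. Hence it grows by at
  least \<open>sqrt (I * J)\<close> in unit time.

  In case of equality the rate is constantly \<open>sqrt (I * J)\<close>, so the arithmetic-geometric mean
  inequality is an equality too: \<open>p = r\<close>, the difference \<open>x - y\<close> is constant, and \<open>S\<close> is
  invariant under translation by it. As \<open>S\<close> is bounded below, \<open>x = y\<close>, and the claim is read
  off from the two equalities.\<close>

lemma prekopa_leindler_interval:
  assumes "interval_density S F" "interval_density S G" "interval_density S H"
    and below: "bdd_below S"
    and mean: "\<And>x y. x \<in> S \<Longrightarrow> y \<in> S \<Longrightarrow> F x * G y \<le> (H ((x + y) / 2))\<^sup>2"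
  defines "I \<equiv> integral\<^sup>L lborel F" and "J \<equiv> integral\<^sup>L lborel G" and "K \<equiv> integral\<^sup>L lborel H"
  shows "I * J \<le> K\<^sup>2"
    and "I * J = K\<^sup>2 \<Longrightarrow> x \<in> S \<Longrightarrow> I * G x = J * F x \<and> F x * G x = (H x)\<^sup>2"
proof -
  interpret F: interval_density S F by fact
  interpret G: interval_density S G by fact
  interpret H: interval_density S H by fact
  have IJ: "0 < I" "0 < J" "0 < K"
    using F.mass_pos G.mass_pos H.mass_pos by (auto simp: I_def J_def K_def)
  define p where "p u = I / F (F.quantile u)" for u
  define r where "r u = J / G (G.quantile u)" for u
  define m where "m u = (F.quantile u + G.quantile u) / 2" for u
  \<comment> \<open>The excess of the mass of \<open>H\<close> swept so far over the guaranteed amount.\<close>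
  define D where "D u = H.cumul (m u) - sqrt (I * J) * u" for u
  have p: "p u > 0" and r: "r u > 0" if "0 < u" "u < 1" for u
    using F.pos F.quantile G.pos G.quantile IJ that by (simp_all add: p_def r_def)
  have m_mem: "m u \<in> S" if "0 < u" "u < 1" for u
  proof -
    have "min (F.quantile u) (G.quantile u) \<in> S" "max (F.quantile u) (G.quantile u) \<in> S"
      using F.quantile[OF that] G.quantile[OF that] by (auto simp: min_def max_def)
    then show ?thesis
      by (rule F.mem_between) (auto simp: m_def min_def max_def field_simps)
  qed
  have H_ge: "sqrt (I * J) \<le> H (m u) * sqrt (p u * r u)" if "0 < u" "u < 1" for u
  proof -
    have "F (F.quantile u) * G (G.quantile u) \<le> (H (m u))\<^sup>2"
      using mean F.quantile[OF that] G.quantile[OF that] by (simp add: m_def)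
    moreover have "F (F.quantile u) > 0" "G (G.quantile u) > 0"
      using F.pos F.quantile[OF that] G.pos G.quantile[OF that] by simp_all
    ultimately have "I * J \<le> (H (m u))\<^sup>2 * (p u * r u)"
      using IJ by (simp add: p_def r_def field_simps)
    then have "sqrt (I * J) \<le> sqrt ((H (m u))\<^sup>2 * (p u * r u))"
      by simp
    then show ?thesis
      using H.nonneg by (simp add: real_sqrt_mult)
  qed
  have amgm: "sqrt (p u * r u) \<le> (p u + r u) / 2" if "0 < u" "u < 1" for u
    using arith_geo_mean_sqrt[of "p u" "r u"] p[OF that] r[OF that] by simp
  have D_deriv: "(D has_real_derivative H (m u) * ((p u + r u) / 2) - sqrt (I * J)) (at u)"
    if "0 < u" "u < 1" for u
  proof -
    have "(m has_real_derivative (p u + r u) / 2) (at u)"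
      unfolding m_def p_def r_def I_def J_def
      using F.quantile_deriv[OF that] G.quantile_deriv[OF that]
      by (auto intro!: derivative_eq_intros simp: add_divide_distrib)
    from DERIV_chain2[OF H.cumul_deriv[OF m_mem[OF that]] this]
    show ?thesis
      unfolding D_def by (auto intro!: derivative_eq_intros)
  qed
  have D_deriv_nonneg: "sqrt (I * J) \<le> H (m u) * ((p u + r u) / 2)" if "0 < u" "u < 1" for u
    using H_ge[OF that] mult_left_mono[OF amgm[OF that] H.nonneg[of "m u"]] by linarith
  have D_mono: "D u \<le> D v" if "0 < u" "u \<le> v" "v < 1" for u v
    by (rule DERIV_nonneg_imp_nondecreasing[OF that(2)])
       (use that D_deriv D_deriv_nonneg in \<open>fastforce intro!: exI conjI\<close>)
  have bound: "sqrt (I * J) * (v - u) \<le> K - (D v - D u)" if "0 < u" "v < 1" "u \<le> v" for u v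
  proof -
    have "H.cumul (m v) - H.cumul (m u) \<le> K"
      using H.cumul_nonneg[of "m u"] H.cumul_le_mass[of "m v"] by (simp add: K_def)
    then show ?thesis
      by (simp add: D_def algebra_simps)
  qed
  \<comment> \<open>The quantile functions live on the open unit interval only, so the total increase of
    \<open>D\<close> is estimated on \<open>e \<le> u \<le> 1 - e\<close> with \<open>e\<close> tending to \<open>0\<close>.\<close>
  have lim: "((\<lambda>e. sqrt (I * J) * ((1 - e) - e)) \<longlongrightarrow> sqrt (I * J) * ((1 - 0) - 0)) (at_right 0)"
    by (intro tendsto_intros)
  have lower: "D v - D u \<le> K - sqrt (I * J)" if "0 < u" "v < 1" "u \<le> v" for u v
  proof -
    have "eventually (\<lambda>e. e < min u (1 - v)) (at_right (0::real))"
      using that by (intro order_tendstoD(2)[OF tendsto_ident_at]) auto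
    moreover have "eventually (\<lambda>e. e > 0) (at_right (0::real))"
      by (simp add: eventually_at_right_less)
    ultimately have "eventually (\<lambda>e. sqrt (I * J) * ((1 - e) - e) \<le> K - (D v - D u)) (at_right 0)"
    proof eventually_elim
      case (elim e)
      then have "D e \<le> D u" "D v \<le> D (1 - e)"
        using that by (auto intro!: D_mono)
      moreover have "sqrt (I * J) * ((1 - e) - e) \<le> K - (D (1 - e) - D e)"
        using elim that by (intro bound) auto
      ultimately show ?case by linarith
    qed
    from tendsto_upperbound[OF lim this] show ?thesis by simp
  qed
  have "sqrt (I * J) \<le> K"
    using lower[of "1/2" "1/2"] by simp
  then have "(sqrt (I * J))\<^sup>2 \<le> K\<^sup>2"
    using IJ by (intro power_mono) auto
  then show "I * J \<le> K\<^sup>2"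
    using IJ by simp
  assume eq: "I * J = K\<^sup>2" and "x \<in> S"
  then have K: "sqrt (I * J) = K"
    using IJ by simp
  have D_const: "D v = D u" if "0 < u" "v < 1" "u \<le> v" for u v
    using lower[OF that] D_mono[of u v] that K by simp
  have D_deriv_zero: "H (m u) * ((p u + r u) / 2) = sqrt (I * J)" if "0 < u" "u < 1" for u
  proof -
    have "(D has_real_derivative 0) (at u)"
    proof (rule has_field_derivative_transform_within_open[where f = "\<lambda>_. D u" and S = "{0<..<1}"])
      fix v :: real assume "v \<in> {0<..<1}"
      then show "D u = D v"
        using D_const[of u v] D_const[of v u] that by fastforce
    qed (use that in auto)
    from DERIV_unique[OF this D_deriv[OF that]] show ?thesis by simp
  qed
  have speeds: "p u = r u" and tight: "H (m u) * p u = sqrt (I * J)" if "0 < u" "u < 1" for u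
  proof -
    have "H (m u) * ((p u + r u) / 2) \<le> H (m u) * sqrt (p u * r u)"
      using D_deriv_zero[OF that] H_ge[OF that] by simp
    then have "(p u + r u) / 2 \<le> sqrt (p u * r u)"
      using H.pos[OF m_mem[OF that]] by simp
    then have "((p u + r u) / 2)\<^sup>2 \<le> (sqrt (p u * r u))\<^sup>2"
      using p[OF that] r[OF that] by (intro power_mono) auto
    also have "\<dots> = p u * r u"
      using p[OF that] r[OF that] by simp
    finally have "(p u - r u)\<^sup>2 \<le> 0"
      by (simp add: power2_eq_square field_simps)
    then show "p u = r u" by simp
    with D_deriv_zero[OF that] show "H (m u) * p u = sqrt (I * J)" by simp
  qed
  define d where "d u = F.quantile u - G.quantile u" for u
  have d_const: "d u = d v" if "0 < u" "u < 1" "0 < v" "v < 1" for u v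
  proof (rule DERIV_isconst3[where a = 0 and b = 1 and f = d])
    fix w :: real assume "w \<in> {0<..<1}"
    then have w: "0 < w" "w < 1" by auto
    have "(d has_real_derivative p w - r w) (at w)"
      unfolding d_def p_def r_def I_def J_def
      using F.quantile_deriv[OF w] G.quantile_deriv[OF w] by (auto intro!: derivative_eq_intros)
    then show "(d has_real_derivative 0) (at w)"
      using speeds[OF w] by simp
  qed (use that in auto)
  \<comment> \<open>The two quantile functions differ by a constant \<open>c\<close>, so \<open>S = S + c\<close>; comparing infima, \<open>c = 0\<close>.\<close>
  define c where "c = d (1/2)"
  have shift: "F.quantile u = G.quantile u + c" if "0 < u" "u < 1" for u
    using d_const[of u "1/2"] that by (simp add: c_def d_def)
  have "c = 0"
  proof -
    have up: "s + c \<in> S" if "s \<in> S" for s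
      using shift[OF G.cumul_fraction[OF that]] G.quantile_cumul[OF that]
        F.quantile(1)[OF G.cumul_fraction[OF that]] by simp
    have down: "s - c \<in> S" if "s \<in> S" for s
      using shift[OF F.cumul_fraction[OF that]] F.quantile_cumul[OF that]
        G.quantile(1)[OF F.cumul_fraction[OF that]] by (metis add_diff_cancel_right')
    have "Inf S \<le> s - \<bar>c\<bar>" if "s \<in> S" for s
      using cInf_lower[OF up[OF that] below] cInf_lower[OF down[OF that] below]
      by (auto simp: abs_if)
    then have "Inf S + \<bar>c\<bar> \<le> Inf S"
      by (intro cInf_greatest F.nonempty_S) (simp add: le_diff_eq)
    then show ?thesis by simp
  qed
  define u where "u = F.cumul x / I"
  have u: "0 < u" "u < 1" and Fx: "F.quantile u = x"
    using F.cumul_fraction[OF \<open>x \<in> S\<close>] F.quantile_cumul[OF \<open>x \<in> S\<close>] by (auto simp: u_def I_def)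
  with shift[OF u] \<open>c = 0\<close> have Gx: "G.quantile u = x" and mx: "m u = x"
    by (auto simp: m_def)
  have FG: "F x > 0" "G x > 0"
    using F.pos G.pos \<open>x \<in> S\<close> by auto
  have 1: "I * G x = J * F x"
    using speeds[OF u] FG by (simp add: p_def r_def Fx Gx field_simps)
  have "(H x * (I / F x))\<^sup>2 = I * J"
    using tight[OF u] IJ by (simp add: mx p_def Fx)
  then have "I * ((H x)\<^sup>2 * I) = I * (J * F x * F x)"
    using FG by (simp add: power2_eq_square field_simps)
  then have "(H x)\<^sup>2 * I = J * F x * F x"
    using IJ by simp
  also have "\<dots> = F x * G x * I"
    using 1 by (simp add: algebra_simps)
  finally have "F x * G x = (H x)\<^sup>2"
    using IJ by simp
  with 1 show "I * G x = J * F x \<and> F x * G x = (H x)\<^sup>2" by simp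
qed

section \<open>Even convex functions and their sublevel sets\<close>

text \<open>These properties pass to the Legendre transform, so that a function and its transform can be
  treated alike.\<close>

definition even_convex :: "(real \<Rightarrow> ereal) \<Rightarrow> bool" where
  "even_convex \<phi> \<longleftrightarrow> (\<forall>x. 0 \<le> \<phi> x) \<and> even_fun \<phi> \<and> convex_fun \<phi> \<and> \<phi> 0 = 0"

lemma even_convex_scale:
  assumes "even_convex \<phi>" "0 \<le> u" "u \<le> 1"
  shows "\<phi> (u * x) \<le> ereal u * \<phi> x"
proof -
  have "\<phi> (u * x + (1 - u) * 0) \<le> ereal u * \<phi> x + ereal (1 - u) * \<phi> 0"
    using assms unfolding even_convex_def convex_fun_def
    by (metis add_diff_cancel_left' add.commute diff_add_cancel diff_ge_0_iff_ge)
  then show ?thesis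
    using assms by (simp add: even_convex_def)
qed

lemma even_convex_abs: "even_convex \<phi> \<Longrightarrow> \<phi> \<bar>x\<bar> = \<phi> x"
  by (auto simp: even_convex_def even_fun_def abs_if)

lemma even_convex_mono:
  assumes "even_convex \<phi>" "\<bar>x\<bar> \<le> \<bar>y\<bar>"
  shows "\<phi> x \<le> \<phi> y"
proof (cases "y = 0")
  case True
  with assms show ?thesis by simp
next
  case False
  define u where "u = \<bar>x\<bar> / \<bar>y\<bar>"
  have u: "0 \<le> u" "u \<le> 1" "\<bar>x\<bar> = u * \<bar>y\<bar>"
    using assms False by (auto simp: u_def)
  have "\<phi> \<bar>x\<bar> \<le> ereal u * \<phi> \<bar>y\<bar>"
    using even_convex_scale[OF assms(1) u(1,2), of "\<bar>y\<bar>"] u(3) by simp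
  also have "\<dots> \<le> ereal 1 * \<phi> \<bar>y\<bar>"
    using assms u by (intro ereal_mult_right_mono) (auto simp: even_convex_def)
  finally show ?thesis
    by (simp add: even_convex_abs[OF assms(1)])
qed

lemma even_convex_sublevel_interval:
  assumes "even_convex \<phi>"
  shows "is_interval {x. \<phi> x \<le> t}"
  unfolding is_interval_1
proof (intro ballI allI impI)
  fix x y z assume xy: "x \<in> {x. \<phi> x \<le> t}" "y \<in> {x. \<phi> x \<le> t}" and "x \<le> z \<and> z \<le> y"
  then have "\<phi> z \<le> \<phi> x \<or> \<phi> z \<le> \<phi> y"
    using even_convex_mono[OF assms, of z] by (cases "0 \<le> z") auto
  with xy show "z \<in> {x. \<phi> x \<le> t}" by auto
qed

lemma even_convex_measurable:
  assumes "even_convex \<phi>"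
  shows "\<phi> \<in> borel_measurable borel"
proof (rule borel_measurableI_le)
  show "{x \<in> space borel. \<phi> x \<le> t} \<in> sets borel" for t
    using real_interval_borel_measurable[OF even_convex_sublevel_interval[OF assms, of t]] by simp
qed

lemma legendre_ge: "ereal (x * y) - \<phi> x \<le> legendre \<phi> y"
  unfolding legendre_def by (rule SUP_upper) simp

lemma legendre_convex:
  assumes "\<phi> 0 = 0" "\<And>x. 0 \<le> \<phi> x"
  shows "convex_fun (legendre \<phi>)"
  unfolding convex_fun_def
proof (intro allI impI)
  fix y z u v :: real
  assume uv: "0 \<le> u" "0 \<le> v" "u + v = 1"
  have nonneg: "0 \<le> legendre \<phi> w" for w
    using legendre_ge[of 0 w \<phi>] assms by (simp add: zero_ereal_def)
  show "legendre \<phi> (u * y + v * z) \<le> ereal u * legendre \<phi> y + ereal v * legendre \<phi> z"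
    unfolding legendre_def[of \<phi> "u * y + v * z"]
  proof (rule SUP_least)
    fix x
    show "ereal (x * (u * y + v * z)) - \<phi> x \<le> ereal u * legendre \<phi> y + ereal v * legendre \<phi> z"
    proof (cases "\<phi> x")
      case (real r)
      have "ereal u * ereal (x * y - r) \<le> ereal u * legendre \<phi> y"
        using legendre_ge[of x y \<phi>] real uv by (intro ereal_mult_left_mono) auto
      moreover have "ereal v * ereal (x * z - r) \<le> ereal v * legendre \<phi> z"
        using legendre_ge[of x z \<phi>] real uv by (intro ereal_mult_left_mono) auto
      ultimately have "ereal u * ereal (x * y - r) + ereal v * ereal (x * z - r)
          \<le> ereal u * legendre \<phi> y + ereal v * legendre \<phi> z"
        by (rule add_mono)
      moreover have "x * (u * y + v * z) - (u + v) * r = u * (x * y - r) + v * (x * z - r)"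
        by (simp add: algebra_simps)
      ultimately show ?thesis
        using real uv by simp
    qed (use nonneg uv assms(2)[of x] in \<open>auto simp: ereal_zero_le_0_iff\<close>)
  qed
qed

lemma even_convex_legendre:
  assumes "even_convex \<phi>"
  shows "even_convex (legendre \<phi>)"
proof -
  have nonneg: "0 \<le> \<phi> x" for x
    using assms by (simp add: even_convex_def)
  have "0 \<le> legendre \<phi> y" for y
    using legendre_ge[of 0 y \<phi>] assms by (simp add: even_convex_def zero_ereal_def)
  moreover have "legendre \<phi> (- y) = legendre \<phi> y" for y
  proof -
    have le: "legendre \<phi> (- y) \<le> legendre \<phi> y" for y
      unfolding legendre_def[of \<phi> "- y"]
    proof (rule SUP_least)
      fix x
      show "ereal (x * - y) - \<phi> x \<le> legendre \<phi> y"
        using legendre_ge[of "- x" y \<phi>] assms by (simp add: even_convex_def even_fun_def)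
    qed
    show ?thesis
      using le[of y] le[of "- y"] by simp
  qed
  moreover have "legendre \<phi> 0 \<le> 0"
    unfolding legendre_def
  proof (rule SUP_least)
    fix x
    show "ereal (x * 0) - \<phi> x \<le> 0"
      using nonneg[of x] by (cases "\<phi> x") auto
  qed
  ultimately show ?thesis
    using legendre_convex[of \<phi>] assms
    by (auto simp: even_convex_def even_fun_def intro: antisym)
qed

text \<open>For an even convex \<open>\<phi>\<close> this is half the length of the sublevel set; as a function
  of the level it is the generalized inverse of \<open>\<phi>\<close> on the positive half-line.\<close>

definition radius :: "(real \<Rightarrow> ereal) \<Rightarrow> real \<Rightarrow> real" where
  "radius \<phi> a = Sup {x. \<phi> x \<le> ereal a}"

text \<open>The nondegenerate functions: neither identically \<open>0\<close> nor infinite off the origin. Positive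
  finite volume implies this, and then all radii at positive levels are positive reals.\<close>

locale profile =
  fixes \<phi> :: "real \<Rightarrow> ereal"
  assumes even_convex: "even_convex \<phi>"
    and sublevel_bounded: "\<And>a. bdd_above {x. \<phi> x \<le> ereal a}"
    and finite_somewhere: "\<exists>x. x \<noteq> 0 \<and> \<phi> x \<noteq> \<infinity>"
begin

lemma nonneg: "0 \<le> \<phi> x" and zero: "\<phi> 0 = 0"
  using even_convex by (auto simp: even_convex_def)

lemma le_radius:
  assumes "\<phi> x \<le> ereal a"
  shows "\<bar>x\<bar> \<le> radius \<phi> a"
  unfolding radius_def using assms
  by (intro cSup_upper sublevel_bounded) (simp add: even_convex_abs[OF even_convex])

lemma less_radius:
  assumes "\<bar>x\<bar> < radius \<phi> a" "0 \<le> a"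
  shows "\<phi> x \<le> ereal a"
proof -
  have "{x. \<phi> x \<le> ereal a} \<noteq> {}"
    using zero assms by (auto intro!: exI[of _ 0])
  then obtain y where "\<phi> y \<le> ereal a" "\<bar>x\<bar> < y"
    using assms less_cSup_iff[OF _ sublevel_bounded] unfolding radius_def by blast
  then show ?thesis
    using even_convex_mono[OF even_convex, of x y] by force
qed

lemma radius_pos:
  assumes "0 < a"
  shows "0 < radius \<phi> a"
proof -
  obtain x r where x: "x \<noteq> 0" "\<phi> x = ereal r" "0 \<le> r"
    using finite_somewhere nonneg by (metis ereal_cases ereal_infty_less_eq(2) ereal_less_eq(5) zero_ereal_def MInfty_neq_PInfty(1))
  define u where "u = a / (a + r)"
  have u: "0 < u" "u \<le> 1"
    using assms x by (auto simp: u_def)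
  have "\<phi> (u * x) \<le> ereal (u * r)"
    using even_convex_scale[OF even_convex, of u x] u x by simp
  also have "u * r \<le> a"
    using assms x by (simp add: u_def field_simps)
  finally have "\<bar>u * x\<bar> \<le> radius \<phi> a"
    by (intro le_radius) simp
  moreover have "0 < \<bar>u * x\<bar>"
    using u x by simp
  ultimately show ?thesis by linarith
qed

lemma radius_nonneg: "0 \<le> a \<Longrightarrow> 0 \<le> radius \<phi> a"
  using le_radius[of 0 a] zero by simp

text \<open>Averages of points at levels \<open>a\<close> and \<open>b\<close> lie at the averaged level. The supremum need not be
  attained, so points slightly inside, scaled by \<open>t < 1\<close>, are averaged. Concavity is the source of
  the continuity of the radius.\<close>

lemma radius_concave:
  assumes "0 \<le> a" "0 \<le> b" "0 \<le> u" "0 \<le> v" "u + v = 1"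
  shows "u * radius \<phi> a + v * radius \<phi> b \<le> radius \<phi> (u * a + v * b)"
proof (rule field_le_mult_one_interval)
  fix t :: real assume t: "0 < t" "t < 1"
  have level: "\<phi> (t * radius \<phi> c) \<le> ereal c" if "0 \<le> c" for c
  proof (cases "radius \<phi> c = 0")
    case True
    with that zero show ?thesis by simp
  next
    case False
    then have "t * radius \<phi> c < radius \<phi> c"
      using radius_nonneg[OF that] t by simp
    then show ?thesis
      using that t radius_nonneg[OF that] by (intro less_radius) auto
  qed
  have "\<phi> (u * (t * radius \<phi> a) + v * (t * radius \<phi> b))
      \<le> ereal u * \<phi> (t * radius \<phi> a) + ereal v * \<phi> (t * radius \<phi> b)"
    using even_convex assms unfolding even_convex_def convex_fun_def by blast
  also have "\<dots> \<le> ereal u * ereal a + ereal v * ereal b"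
    using assms by (intro add_mono ereal_mult_left_mono level) auto
  also have "\<dots> = ereal (u * a + v * b)"
    by simp
  finally have "\<bar>u * (t * radius \<phi> a) + v * (t * radius \<phi> b)\<bar> \<le> radius \<phi> (u * a + v * b)"
    by (rule le_radius)
  then show "t * (u * radius \<phi> a + v * radius \<phi> b) \<le> radius \<phi> (u * a + v * b)"
    by (simp add: algebra_simps)
qed

lemma continuous_radius: "continuous_on {0<..} (radius \<phi>)"
proof -
  have "convex_on {0<..} (\<lambda>a. - radius \<phi> a)"
  proof (rule convex_onI)
    fix t x y :: real
    assume "0 < t" "t < 1" "x \<in> {0<..}" "y \<in> {0<..}"
    then show "- radius \<phi> ((1 - t) *\<^sub>R x + t *\<^sub>R y) \<le> (1 - t) * - radius \<phi> x + t * - radius \<phi> y"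
      using radius_concave[of x y "1 - t" t] by simp
  qed simp
  then have "continuous_on {0<..} (\<lambda>a. - radius \<phi> a)"
    by (intro convex_on_continuous) auto
  from continuous_on_minus[OF this] show ?thesis by simp
qed

lemma emeasure_sublevel:
  assumes "0 \<le> a"
  shows "emeasure lborel {x. \<phi> x \<le> ereal a} = ennreal (2 * radius \<phi> a)"
proof (rule antisym)
  have r: "0 \<le> radius \<phi> a"
    using radius_nonneg assms .
  have "{x. \<phi> x \<le> ereal a} \<subseteq> {- radius \<phi> a..radius \<phi> a}"
  proof
    fix x assume "x \<in> {x. \<phi> x \<le> ereal a}"
    then show "x \<in> {- radius \<phi> a..radius \<phi> a}"
      using le_radius[of x a] by (auto simp: abs_le_iff)
  qed
  then have "emeasure lborel {x. \<phi> x \<le> ereal a} \<le> emeasure lborel {- radius \<phi> a..radius \<phi> a}"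
    by (rule emeasure_mono) simp
  then show "emeasure lborel {x. \<phi> x \<le> ereal a} \<le> ennreal (2 * radius \<phi> a)"
    using r by simp
  have "{- radius \<phi> a<..<radius \<phi> a} \<subseteq> {x. \<phi> x \<le> ereal a}"
    using less_radius assms by (auto simp: abs_less_iff)
  then have "emeasure lborel {- radius \<phi> a<..<radius \<phi> a} \<le> emeasure lborel {x. \<phi> x \<le> ereal a}"
    by (rule emeasure_mono) (simp add: real_interval_borel_measurable even_convex_sublevel_interval[OF even_convex])
  then show "ennreal (2 * radius \<phi> a) \<le> emeasure lborel {x. \<phi> x \<le> ereal a}"
    using r by simp
qed

end

text \<open>Young's inequality \<open>x * y \<le> \<phi> x + legendre \<phi> y\<close>, taken at the end points of the two
  sublevel sets, is all that links the volumes of a function and of its Legendre transform.\<close>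

lemma radius_mult_legendre_le:
  assumes "profile \<phi>" "profile (legendre \<phi>)" "0 < a" "0 < b"
  shows "radius \<phi> a * radius (legendre \<phi>) b \<le> a + b"
proof -
  interpret p: profile \<phi> by fact
  interpret l: profile "legendre \<phi>" by fact
  have prod: "x * y \<le> a + b" if "\<phi> x \<le> ereal a" "legendre \<phi> y \<le> ereal b" for x y
    using legendre_ge[of x y \<phi>] that p.nonneg[of x] by (cases "\<phi> x"; cases "legendre \<phi> y") auto
  have X: "radius \<phi> a > 0" and Y: "radius (legendre \<phi>) b > 0"
    using assms p.radius_pos l.radius_pos by auto
  show ?thesis
  proof (rule field_le_mult_one_interval)
    fix t :: real assume t: "0 < t" "t < 1"
    define s where "s = sqrt t"
    have s: "0 < s" "s < 1" "s * s = t"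
      using t by (auto simp: s_def)
    have "(s * radius \<phi> a) * (s * radius (legendre \<phi>) b) \<le> a + b"
      using X Y s assms by (intro prod p.less_radius l.less_radius) (auto simp: abs_mult)
    then show "t * (radius \<phi> a * radius (legendre \<phi>) b) \<le> a + b"
      using s(3) by (metis mult.assoc mult.left_commute)
  qed
qed

text \<open>A nondegenerate even convex function is recovered from its radii: \<open>\<phi> x \<le> a\<close> as soon as \<open>\<bar>x\<bar>\<close> is below the
  radius at level \<open>a\<close>, and \<open>\<phi> x > a\<close> as soon as it is above.\<close>

lemma quadratic_of_radius:
  assumes "profile \<phi>" "0 < c" and radius: "\<And>a. 0 < a \<Longrightarrow> (radius \<phi> a)\<^sup>2 = 2 * a / c"
  shows "\<phi> x = ereal (c * x\<^sup>2 / 2)"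
proof -
  interpret profile \<phi> by fact
  define t where "t = c * x\<^sup>2 / 2"
  have t: "t \<ge> 0" and xt: "x\<^sup>2 = 2 * t / c"
    using \<open>0 < c\<close> by (auto simp: t_def)
  have upper: "\<phi> x \<le> ereal a" if "t < a" for a
  proof (rule less_radius)
    have "\<bar>x\<bar>\<^sup>2 < (radius \<phi> a)\<^sup>2"
      using that t \<open>0 < c\<close> by (simp add: radius xt divide_strict_right_mono)
    then show "\<bar>x\<bar> < radius \<phi> a"
      using radius_nonneg[of a] that t by (auto intro: power2_less_imp_less)
  qed (use that t in simp)
  have lower: "ereal a \<le> \<phi> x" if "0 < a" "a < t" for a
  proof (rule ccontr)
    assume "\<not> ?thesis"
    then have "\<bar>x\<bar>\<^sup>2 \<le> (radius \<phi> a)\<^sup>2"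
      by (intro power_mono le_radius) auto
    then show False
      using that \<open>0 < c\<close> by (simp add: radius xt divide_le_cancel)
  qed
  have "\<phi> x \<le> ereal t"
  proof (rule ccontr)
    assume "\<not> ?thesis"
    then obtain a where "ereal t < ereal a" "ereal a < \<phi> x"
      using ereal_dense2[of "ereal t" "\<phi> x"] by (auto simp: not_le)
    then show False
      using upper[of a] by simp
  qed
  moreover have "ereal t \<le> \<phi> x"
  proof (rule ccontr)
    assume "\<not> ?thesis"
    then obtain a where "\<phi> x < ereal a" "ereal a < ereal t"
      using ereal_dense2[of "\<phi> x" "ereal t"] by (auto simp: not_le)
    moreover from this have "0 < a"
      using nonneg[of x] by (metis ereal_less(2) le_less_trans)
    ultimately show False
      using lower[of a] by simp
  qed
  ultimately show ?thesis by (simp add: t_def)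
qed

section \<open>Volumes as integrals over levels\<close>

lemma weight_antimono:
  assumes "1 \<le> \<beta>" "0 \<le> s" "s \<le> t"
  shows "weight \<beta> (ereal t) \<le> weight \<beta> (ereal s)"
  using assms
  by (cases \<beta>) (auto simp: weight_def one_ereal_def intro!: powr_mono2' add_pos_nonneg divide_right_mono)

lemma weight_pos:
  assumes "1 \<le> \<beta>" "0 \<le> t"
  shows "0 < weight \<beta> (ereal t)"
proof (cases \<beta>)
  case (real b)
  then have "0 < 1 + t / b"
    using assms by (intro add_pos_nonneg) (auto simp: one_ereal_def)
  then show ?thesis
    using real by (simp add: weight_def)
qed (use assms in \<open>auto simp: weight_def\<close>)

text \<open>If a sublevel set of an even convex function is unbounded it is the whole line, and the
  integrand of the volume is bounded below by a positive constant.\<close>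

lemma bounded_sublevel_of_finite_V:
  assumes "1 \<le> \<beta>" "even_convex \<phi>" "V \<beta> \<phi> < \<infinity>"
  shows "bdd_above {x. \<phi> x \<le> ereal a}"
proof (rule ccontr)
  assume unbounded: "\<not> ?thesis"
  have le: "\<phi> x \<le> ereal a" for x
  proof -
    obtain y where "\<phi> y \<le> ereal a" "\<bar>x\<bar> < y"
      using unbounded unfolding bdd_above_def by (auto simp: not_le)
    then show ?thesis
      using even_convex_mono[OF assms(2), of x y] by force
  qed
  have nonneg: "0 \<le> \<phi> x" for x
    using assms(2) by (simp add: even_convex_def)
  have "0 \<le> a"
    using order_trans[OF nonneg[of 0] le[of 0]] by simp
  have ge: "weight \<beta> (ereal a) \<le> weight \<beta> (\<phi> x)" for x
    using le[of x] nonneg[of x] assms(1) by (cases "\<phi> x") (auto intro: weight_antimono)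
  have "(\<integral>\<^sup>+ x. ennreal (weight \<beta> (ereal a)) \<partial>(lborel :: real measure)) \<le> V \<beta> \<phi>"
    unfolding V_def by (rule nn_integral_mono) (intro ennreal_leI ge)
  moreover have "(\<integral>\<^sup>+ x. ennreal (weight \<beta> (ereal a)) \<partial>(lborel :: real measure)) = \<infinity>"
    using weight_pos[OF assms(1) \<open>0 \<le> a\<close>] by (simp add: ennreal_mult_top)
  ultimately show False
    using assms(3) by simp
qed

lemma finite_somewhere_of_V_pos:
  assumes "0 < V \<beta> \<phi>"
  shows "\<exists>x. x \<noteq> 0 \<and> \<phi> x \<noteq> \<infinity>"
proof (rule ccontr)
  assume "\<not> ?thesis"
  then have "V \<beta> \<phi> = (\<integral>\<^sup>+ x. ennreal (weight \<beta> (\<phi> x)) * indicator {0} x \<partial>lborel)"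
    unfolding V_def by (intro nn_integral_cong) (auto simp: indicator_def weight_def)
  also have "\<dots> = 0"
    by (simp add: nn_integral_indicator_singleton)
  finally show False
    using assms by simp
qed

lemma profile_of_V:
  assumes "1 \<le> \<beta>" "even_convex \<phi>" "0 < V \<beta> \<phi>" "V \<beta> \<phi> < \<infinity>"
  shows "profile \<phi>"
  using assms bounded_sublevel_of_finite_V finite_somewhere_of_V_pos
  by unfold_locales blast+

lemma even_convex_q: "even_convex q"
proof -
  have "(u * x + v * y)\<^sup>2 / 2 \<le> u * (x\<^sup>2 / 2) + v * (y\<^sup>2 / 2)"
    if "0 \<le> u" "0 \<le> v" "u + v = 1" for u v x y :: real
  proof -
    have v: "v = 1 - u" using that by simp
    have "u * x\<^sup>2 + v * y\<^sup>2 - (u * x + v * y)\<^sup>2 = u * v * (x - y)\<^sup>2"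
      unfolding v by (simp add: power2_eq_square algebra_simps)
    moreover have "0 \<le> u * v * (x - y)\<^sup>2"
      using that by simp
    ultimately show ?thesis by simp
  qed
  then show ?thesis
    by (auto simp: even_convex_def even_fun_def convex_fun_def q_def zero_ereal_def)
qed

lemma sublevel_q:
  assumes "0 \<le> a"
  shows "{x. q x \<le> ereal a} = {- sqrt (2 * a)..sqrt (2 * a)}"
proof -
  have "x \<in> {x. q x \<le> ereal a} \<longleftrightarrow> x \<in> {- sqrt (2 * a)..sqrt (2 * a)}" for x
  proof -
    have "x \<in> {x. q x \<le> ereal a} \<longleftrightarrow> x\<^sup>2 \<le> 2 * a"
      by (auto simp: q_def)
    also have "\<dots> \<longleftrightarrow> sqrt (x\<^sup>2) \<le> sqrt (2 * a)"
      by (rule real_sqrt_le_iff[symmetric])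
    also have "\<dots> \<longleftrightarrow> \<bar>x\<bar> \<le> sqrt (2 * a)"
      by (simp only: real_sqrt_abs)
    also have "\<dots> \<longleftrightarrow> x \<in> {- sqrt (2 * a)..sqrt (2 * a)}"
      by (simp only: abs_le_iff atLeastAtMost_iff minus_le_iff[of x] conj_commute)
    finally show ?thesis .
  qed
  then show ?thesis by (rule set_eqI)
qed

lemma radius_q: "0 \<le> a \<Longrightarrow> radius q a = sqrt (2 * a)"
  by (simp add: radius_def sublevel_q)

lemma profile_q: "profile q"
proof
  show "bdd_above {x. q x \<le> ereal a}" for a
  proof (rule bdd_above_mono)
    show "bdd_above {- sqrt (2 * \<bar>a\<bar>)..sqrt (2 * \<bar>a\<bar>)}"
      by simp
    show "{x. q x \<le> ereal a} \<subseteq> {- sqrt (2 * \<bar>a\<bar>)..sqrt (2 * \<bar>a\<bar>)}"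
      unfolding sublevel_q[OF abs_ge_zero, symmetric] by (auto simp: q_def)
  qed
  show "\<exists>x. x \<noteq> 0 \<and> q x \<noteq> \<infinity>"
    by (intro exI[of _ 1]) (simp add: q_def)
qed (rule even_convex_q)

text \<open>A level \<open>\<theta> \<alpha>\<close> is reached at the parameter \<open>\<alpha>\<close>, and \<open>weight_eq\<close> says that \<open>\<rho>\<close> is the density of
  the weight of all higher levels. Along such a parametrization the radius \<open>sqrt (2 * \<theta> \<alpha>)\<close> of \<open>q\<close>
  contributes \<open>2 * sqrt (2 * \<theta> \<alpha>) * \<rho> \<alpha>\<close> to the volume, and \<open>level_mean\<close> is exactly the hypothesis
  of the Prekopa-Leindler inequality for radii with product at most \<open>\<theta> \<alpha> + \<theta> \<gamma>\<close>. The choice of \<open>\<theta>\<close>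
  is free up to this condition, and finding it is the point of the proof.\<close>

locale level_parametrization =
  fixes \<beta> :: ereal and S :: "real set" and \<theta> \<rho> :: "real \<Rightarrow> real"
  assumes open_S: "open S" and interval_S: "is_interval S" and nonempty_S: "S \<noteq> {}"
    and below_S: "bdd_below S"
    and cont_level: "continuous_on S \<theta>" and cont_density: "continuous_on S \<rho>"
    and level_pos: "\<And>\<alpha>. \<alpha> \<in> S \<Longrightarrow> 0 < \<theta> \<alpha>" and density_pos: "\<And>\<alpha>. \<alpha> \<in> S \<Longrightarrow> 0 < \<rho> \<alpha>"
    and level_onto: "\<And>a. 0 < a \<Longrightarrow> \<exists>\<alpha>\<in>S. \<theta> \<alpha> = a"
    and weight_eq: "\<And>t. 0 \<le> t \<Longrightarrow>
      (\<integral>\<^sup>+ \<alpha>. ennreal (\<rho> \<alpha>) * indicator {\<alpha> \<in> S. t \<le> \<theta> \<alpha>} \<alpha> \<partial>lborel) = ennreal (weight \<beta> (ereal t))"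
    and level_mean: "\<And>\<alpha> \<gamma>. \<alpha> \<in> S \<Longrightarrow> \<gamma> \<in> S \<Longrightarrow>
      (\<theta> \<alpha> + \<theta> \<gamma>) * (\<rho> \<alpha> * \<rho> \<gamma>) \<le> 2 * \<theta> ((\<alpha> + \<gamma>) / 2) * (\<rho> ((\<alpha> + \<gamma>) / 2))\<^sup>2"
begin

definition level_volume :: "(real \<Rightarrow> ereal) \<Rightarrow> real \<Rightarrow> real" where
  "level_volume \<phi> \<alpha> = indicator S \<alpha> *\<^sub>R (2 * radius \<phi> (\<theta> \<alpha>) * \<rho> \<alpha>)"

text \<open>Writing the weight at \<open>\<phi> x\<close> as the mass of the parameters with level at least \<open>\<phi> x\<close> and exchanging
  the integrals leaves, for each parameter, the length of a sublevel set.\<close>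

lemma layer_cake:
  assumes "profile \<phi>"
  shows "V \<beta> \<phi> = (\<integral>\<^sup>+ \<alpha>. ennreal (level_volume \<phi> \<alpha>) \<partial>lborel)"
proof -
  interpret profile \<phi> by fact
  have S_meas [measurable]: "S \<in> sets borel"
    using open_S by simp
  define r where "r \<alpha> = indicator S \<alpha> *\<^sub>R \<rho> \<alpha>" for \<alpha>
  define l where "l \<alpha> = indicator S \<alpha> *\<^sub>R \<theta> \<alpha>" for \<alpha>
  have [measurable]: "r \<in> borel_measurable borel" "l \<in> borel_measurable borel"
    unfolding r_def l_def
    by (intro borel_measurable_continuous_on_indicator cont_density cont_level S_meas)+
  have [measurable]: "\<phi> \<in> borel_measurable borel"
    by (rule even_convex_measurable[OF even_convex])
  have slice: "ennreal (weight \<beta> (\<phi> x))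
      = (\<integral>\<^sup>+ \<alpha>. ennreal (r \<alpha>) * indicator {x. \<phi> x \<le> ereal (l \<alpha>)} x \<partial>lborel)" for x
  proof (cases "\<phi> x")
    case (real t)
    with nonneg[of x] have t: "0 \<le> t" by simp
    have "ennreal (weight \<beta> (\<phi> x))
        = (\<integral>\<^sup>+ \<alpha>. ennreal (\<rho> \<alpha>) * indicator {\<alpha> \<in> S. t \<le> \<theta> \<alpha>} \<alpha> \<partial>lborel)"
      using weight_eq[OF t] real by simp
    also have "\<dots> = (\<integral>\<^sup>+ \<alpha>. ennreal (r \<alpha>) * indicator {x. \<phi> x \<le> ereal (l \<alpha>)} x \<partial>lborel)"
      by (intro nn_integral_cong) (auto simp: indicator_def r_def l_def real)
    finally show ?thesis .
  qed (use nonneg[of x] in \<open>auto simp: weight_def\<close>)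
  have "V \<beta> \<phi> = (\<integral>\<^sup>+ x. \<integral>\<^sup>+ \<alpha>. ennreal (r \<alpha>) * indicator {x. \<phi> x \<le> ereal (l \<alpha>)} x \<partial>lborel \<partial>lborel)"
    unfolding V_def by (simp add: slice)
  also have "\<dots> = (\<integral>\<^sup>+ \<alpha>. \<integral>\<^sup>+ x. ennreal (r \<alpha>) * indicator {x. \<phi> x \<le> ereal (l \<alpha>)} x \<partial>lborel \<partial>lborel)"
    by (rule lborel_pair.Fubini') measurable
  also have "\<dots> = (\<integral>\<^sup>+ \<alpha>. ennreal (level_volume \<phi> \<alpha>) \<partial>lborel)"
  proof (intro nn_integral_cong)
    fix \<alpha>
    have "(\<integral>\<^sup>+ x. ennreal (r \<alpha>) * indicator {x. \<phi> x \<le> ereal (l \<alpha>)} x \<partial>lborel)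
        = ennreal (r \<alpha>) * emeasure lborel {x. \<phi> x \<le> ereal (l \<alpha>)}"
      by (rule nn_integral_cmult_indicator) measurable
    also have "\<dots> = ennreal (level_volume \<phi> \<alpha>)"
    proof (cases "\<alpha> \<in> S")
      case True
      then show ?thesis
        using level_pos[OF True] density_pos[OF True] radius_nonneg[of "\<theta> \<alpha>"]
        by (simp add: r_def l_def level_volume_def emeasure_sublevel mult.commute flip: ennreal_mult)
    qed (simp add: r_def level_volume_def)
    finally show "(\<integral>\<^sup>+ x. ennreal (r \<alpha>) * indicator {x. \<phi> x \<le> ereal (l \<alpha>)} x \<partial>lborel)
        = ennreal (level_volume \<phi> \<alpha>)" .
  qed
  finally show ?thesis .
qed

lemma interval_density_level_volume:
  assumes "profile \<phi>" "V \<beta> \<phi> < \<infinity>"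
  shows "interval_density S (level_volume \<phi>)"
    and "V \<beta> \<phi> = ennreal (integral\<^sup>L lborel (level_volume \<phi>))"
proof -
  interpret profile \<phi> by fact
  have cont: "continuous_on S (\<lambda>\<alpha>. 2 * radius \<phi> (\<theta> \<alpha>) * \<rho> \<alpha>)"
    using level_pos
    by (intro continuous_intros cont_density continuous_on_compose2[OF continuous_radius cont_level]) auto
  have pos: "0 < level_volume \<phi> \<alpha>" if "\<alpha> \<in> S" for \<alpha>
    using that level_pos density_pos radius_pos by (simp add: level_volume_def)
  have zero: "level_volume \<phi> \<alpha> = 0" if "\<alpha> \<notin> S" for \<alpha>
    using that by (simp add: level_volume_def)
  have nonneg: "0 \<le> level_volume \<phi> \<alpha>" for \<alpha>
    using pos[of \<alpha>] zero[of \<alpha>] by (cases "\<alpha> \<in> S") auto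
  have meas: "level_volume \<phi> \<in> borel_measurable borel"
    unfolding level_volume_def using open_S cont
    by (intro borel_measurable_continuous_on_indicator) auto
  have int: "integrable lborel (level_volume \<phi>)"
    using assms(2) nonneg meas layer_cake[OF assms(1)]
    by (intro integrableI_nonneg) auto
  show "interval_density S (level_volume \<phi>)"
  proof
    show "continuous_on S (level_volume \<phi>)"
      using cont by (rule continuous_on_eq) (simp add: level_volume_def)
  qed (use open_S interval_S nonempty_S pos zero int in auto)
  show "V \<beta> \<phi> = ennreal (integral\<^sup>L lborel (level_volume \<phi>))"
    using layer_cake[OF assms(1)] nn_integral_eq_integral[OF int] nonneg by simp
qed

text \<open>The level volumes of \<open>\<phi>\<close>, its Legendre transform and \<open>q\<close> satisfy the hypothesis of the
  Prekopa-Leindler inequality. Equality yields, at every level \<open>a\<close>, radii \<open>X\<close> and \<open>Y\<close> that are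
  proportional with a factor independent of \<open>a\<close> and have the product \<open>X * Y = 2 * a\<close>; so \<open>X\<^sup>2\<close> is
  proportional to \<open>a\<close> and \<open>\<phi>\<close> is a quadratic.\<close>

theorem santalo_inequality:
  assumes "profile \<phi>" "profile (legendre \<phi>)"
    and finite: "V \<beta> \<phi> < \<infinity>" "V \<beta> (legendre \<phi>) < \<infinity>" "V \<beta> q < \<infinity>"
  shows "V \<beta> \<phi> * V \<beta> (legendre \<phi>) \<le> (V \<beta> q)\<^sup>2"
    and "V \<beta> \<phi> * V \<beta> (legendre \<phi>) = (V \<beta> q)\<^sup>2 \<Longrightarrow> \<exists>c>0. \<forall>x. \<phi> x = ereal (c * x\<^sup>2 / 2)"
proof -
  interpret p: profile \<phi> by fact
  interpret l: profile "legendre \<phi>" by fact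
  let ?F = "level_volume \<phi>" and ?G = "level_volume (legendre \<phi>)" and ?H = "level_volume q"
  define I where "I = integral\<^sup>L lborel ?F"
  define J where "J = integral\<^sup>L lborel ?G"
  define K where "K = integral\<^sup>L lborel ?H"
  interpret F: interval_density S ?F
    by (rule interval_density_level_volume) fact+
  interpret G: interval_density S ?G
    by (rule interval_density_level_volume) fact+
  interpret H: interval_density S ?H
    by (rule interval_density_level_volume) (fact profile_q finite)+
  have IJK: "0 < I" "0 < J" "0 < K"
    using F.mass_pos G.mass_pos H.mass_pos by (simp_all add: I_def J_def K_def)
  have V: "V \<beta> \<phi> = ennreal I" "V \<beta> (legendre \<phi>) = ennreal J" "V \<beta> q = ennreal K"
    unfolding I_def J_def K_def
    by (rule interval_density_level_volume; fact assms profile_q)+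
  have mean: "?F \<alpha> * ?G \<gamma> \<le> (?H ((\<alpha> + \<gamma>) / 2))\<^sup>2" if "\<alpha> \<in> S" "\<gamma> \<in> S" for \<alpha> \<gamma>
  proof -
    define m where "m = (\<alpha> + \<gamma>) / 2"
    have m: "m \<in> S"
    proof (rule F.mem_between)
      show "min \<alpha> \<gamma> \<in> S" "max \<alpha> \<gamma> \<in> S"
        using that by (auto simp: min_def max_def)
    qed (auto simp: m_def min_def max_def field_simps)
    have "?F \<alpha> * ?G \<gamma> = 4 * ((radius \<phi> (\<theta> \<alpha>) * radius (legendre \<phi>) (\<theta> \<gamma>)) * (\<rho> \<alpha> * \<rho> \<gamma>))"
      using that by (simp add: level_volume_def)
    also have "\<dots> \<le> 4 * ((\<theta> \<alpha> + \<theta> \<gamma>) * (\<rho> \<alpha> * \<rho> \<gamma>))"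
      using that level_pos density_pos radius_mult_legendre_le[OF assms(1,2)]
      by (intro mult_left_mono mult_right_mono) (auto intro!: mult_nonneg_nonneg less_imp_le)
    also have "\<dots> \<le> 4 * (2 * \<theta> m * (\<rho> m)\<^sup>2)"
      using level_mean[OF that] unfolding m_def by (intro mult_left_mono) auto
    also have "\<dots> = (2 * sqrt (2 * \<theta> m) * \<rho> m)\<^sup>2"
      using level_pos[OF m] by (simp add: power_mult_distrib)
    also have "\<dots> = (?H m)\<^sup>2"
      using m level_pos[OF m] by (simp add: level_volume_def radius_q less_imp_le)
    finally show ?thesis by (simp add: m_def)
  qed
  note pl = prekopa_leindler_interval[OF F.interval_density_axioms G.interval_density_axioms
      H.interval_density_axioms below_S mean, folded I_def J_def K_def]
  show "V \<beta> \<phi> * V \<beta> (legendre \<phi>) \<le> (V \<beta> q)\<^sup>2"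
    using pl(1) IJK by (simp add: V ennreal_power ennreal_leI flip: ennreal_mult)
  assume "V \<beta> \<phi> * V \<beta> (legendre \<phi>) = (V \<beta> q)\<^sup>2"
  then have eq: "I * J = K\<^sup>2"
    using IJK by (simp add: V ennreal_power flip: ennreal_mult)
  have "(radius \<phi> a)\<^sup>2 = 2 * a / (J / I)" if a: "0 < a" for a
  proof -
    obtain \<alpha> where \<alpha>: "\<alpha> \<in> S" "\<theta> \<alpha> = a"
      using level_onto[OF a] by blast
    define X where "X = radius \<phi> a"
    define Y where "Y = radius (legendre \<phi>) a"
    have \<rho>: "\<rho> \<alpha> > 0" using density_pos \<alpha> by simp
    have "I * ?G \<alpha> = J * ?F \<alpha>" "?F \<alpha> * ?G \<alpha> = (?H \<alpha>)\<^sup>2"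
      using pl(2)[OF _ _ eq \<alpha>(1)] by auto
    then have 1: "I * Y = J * X" and 2: "X * Y = 2 * a"
      using \<alpha> \<rho> that by (auto simp: level_volume_def radius_q X_def Y_def power_mult_distrib power2_eq_square)
    have "X\<^sup>2 * J = X * (I * Y)"
      using 1 by (simp add: power2_eq_square)
    also have "\<dots> = 2 * a * I"
      using 2 by (simp add: mult.left_commute)
    finally show ?thesis
      using IJK by (simp add: X_def field_simps)
  qed
  then have "\<phi> x = ereal (J / I * x\<^sup>2 / 2)" for x
    using IJK by (intro quadratic_of_radius[OF assms(1)]) auto
  then show "\<exists>c>0. \<forall>x. \<phi> x = ereal (c * x\<^sup>2 / 2)"
    using IJK by (intro exI[of _ "J / I"]) auto
qed

end

section \<open>The two level parametrizations\<close>

text \<open>For the exponential weight the levels themselves are a suitable parameter: the mean condition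
  holds with equality throughout.\<close>

lemma level_parametrization_infinite:
  "level_parametrization \<infinity> {0<..} (\<lambda>\<alpha>. \<alpha>) (\<lambda>\<alpha>. exp (- \<alpha>))"
proof
  fix t :: real assume "0 \<le> t"
  have "(\<integral>\<^sup>+ \<alpha>. ennreal (exp (- \<alpha>)) * indicator {\<alpha> \<in> {0<..}. t \<le> \<alpha>} \<alpha> \<partial>lborel)
      = (\<integral>\<^sup>+ \<alpha>. ennreal (exp (- \<alpha>)) * indicator {t..} \<alpha> \<partial>lborel)"
  proof (rule nn_integral_cong_AE)
    show "AE \<alpha> in lborel. ennreal (exp (- \<alpha>)) * indicator {\<alpha> \<in> {0<..}. t \<le> \<alpha>} \<alpha>
        = ennreal (exp (- \<alpha>)) * indicator {t..} \<alpha>"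
      by (rule AE_mp[OF AE_lborel_singleton[of "0::real"] AE_I2])
         (use \<open>0 \<le> t\<close> in \<open>auto simp: indicator_def\<close>)
  qed
  also have "\<dots> = ennreal (0 - - exp (- t))"
  proof (rule nn_integral_FTC_atLeast)
    have "((\<lambda>x::real. - exp (- x)) \<longlongrightarrow> - 0) at_top"
      by (intro tendsto_minus filterlim_compose[OF exp_at_bot] filterlim_uminus_at_bot_at_top)
    then show "((\<lambda>x::real. - exp (- x)) \<longlongrightarrow> 0) at_top" by simp
  qed (auto intro!: derivative_eq_intros)
  finally show "(\<integral>\<^sup>+ \<alpha>. ennreal (exp (- \<alpha>)) * indicator {\<alpha> \<in> {0<..}. t \<le> \<alpha>} \<alpha> \<partial>lborel)
      = ennreal (weight \<infinity> (ereal t))"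
    by (simp add: weight_def)
next
  fix \<alpha> \<gamma> :: real
  have "exp (- \<alpha>) * exp (- \<gamma>) = (exp (- ((\<alpha> + \<gamma>) / 2)))\<^sup>2"
    by (simp add: power2_eq_square field_simps flip: exp_add)
  then show "(\<alpha> + \<gamma>) * (exp (- \<alpha>) * exp (- \<gamma>)) \<le> 2 * ((\<alpha> + \<gamma>) / 2) * (exp (- ((\<alpha> + \<gamma>) / 2)))\<^sup>2"
    by simp
qed (auto intro!: continuous_intros)

text \<open>The condition on the level reads \<open>\<tau> \<le> \<alpha>\<close> with \<open>tan \<tau> = sqrt (t / b)\<close>; the density has
  the antiderivative \<open>- (cos \<alpha> powr (2 * b + 2))\<close>, and \<open>(cos \<tau>)\<^sup>2 = 1 / (1 + t / b)\<close>.\<close>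

lemma weight_trig_integral:
  fixes b t :: real
  assumes "0 < b" "0 \<le> t"
  shows "(\<integral>\<^sup>+ \<alpha>. ennreal ((2 * b + 2) * (sin \<alpha> * cos \<alpha> powr (2 * b + 1)))
            * indicator {\<alpha> \<in> {0<..<pi / 2}. t \<le> b * (tan \<alpha>)\<^sup>2} \<alpha> \<partial>lborel)
    = ennreal ((1 + t / b) powr (- b - 1))"
proof -
  let ?\<rho> = "\<lambda>\<alpha>. (2 * b + 2) * (sin \<alpha> * cos \<alpha> powr (2 * b + 1))"
  define \<tau> where "\<tau> = arctan (sqrt (t / b))"
  have \<tau>: "0 \<le> \<tau>" "\<tau> < pi / 2"
    using assms arctan_ubound by (auto simp: \<tau>_def)
  have level: "t \<le> b * (tan \<alpha>)\<^sup>2 \<longleftrightarrow> \<tau> \<le> \<alpha>" if "\<alpha> \<in> {0<..<pi / 2}" for \<alpha>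
  proof -
    have "t \<le> b * (tan \<alpha>)\<^sup>2 \<longleftrightarrow> t / b \<le> (tan \<alpha>)\<^sup>2"
      using assms by (simp add: field_simps)
    also have "\<dots> \<longleftrightarrow> sqrt (t / b) \<le> tan \<alpha>"
      using that tan_gt_zero[of \<alpha>] by (metis abs_of_pos greaterThanLessThan_iff real_sqrt_abs real_sqrt_le_iff)
    also have "\<dots> \<longleftrightarrow> \<tau> \<le> arctan (tan \<alpha>)"
      by (simp add: \<tau>_def arctan_le_iff)
    also have "arctan (tan \<alpha>) = \<alpha>"
      using that by (intro arctan_tan) auto
    finally show ?thesis .
  qed
  \<comment> \<open>At the end points \<open>0\<close> and \<open>pi / 2\<close> the sine or the cosine vanishes, so they may be added.\<close>
  have "?\<rho> \<alpha> = 0" if "\<alpha> \<in> {\<tau>..pi / 2}" "\<alpha> \<notin> {0<..<pi / 2}" for \<alpha>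
  proof -
    have "\<alpha> = 0 \<or> \<alpha> = pi / 2" using that \<tau> by auto
    then show ?thesis
    proof
      assume "\<alpha> = pi / 2"
      then have "cos \<alpha> = 0" by (simp only: cos_pi_half)
      then show ?thesis by simp
    qed simp
  qed
  then have "(\<integral>\<^sup>+ \<alpha>. ennreal (?\<rho> \<alpha>) * indicator {\<alpha> \<in> {0<..<pi / 2}. t \<le> b * (tan \<alpha>)\<^sup>2} \<alpha> \<partial>lborel)
      = (\<integral>\<^sup>+ \<alpha>. ennreal (?\<rho> \<alpha>) * indicator {\<tau>..pi / 2} \<alpha> \<partial>lborel)"
    using level by (intro nn_integral_cong) (fastforce simp: indicator_def)
  also have "\<dots> = ennreal (- (cos (pi / 2) powr (2 * b + 2)) - - (cos \<tau> powr (2 * b + 2)))"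
  proof (rule nn_integral_has_integral_lebesgue')
    show "0 \<le> ?\<rho> \<alpha>" if "\<alpha> \<in> {\<tau>..pi / 2}" for \<alpha>
      using that \<tau> assms sin_ge_zero[of \<alpha>] by auto
    show "(?\<rho> has_integral (- (cos (pi / 2) powr (2 * b + 2)) - - (cos \<tau> powr (2 * b + 2)))) {\<tau>..pi / 2}"
    proof (rule fundamental_theorem_of_calculus_interior)
      show "continuous_on {\<tau>..pi / 2} (\<lambda>\<alpha>. - (cos \<alpha> powr (2 * b + 2)))"
        using \<tau> assms by (intro continuous_intros continuous_on_powr') (auto intro: cos_ge_zero)
      fix \<alpha> assume "\<alpha> \<in> {\<tau><..<pi / 2}"
      then have "cos \<alpha> > 0"
        using \<tau> by (intro cos_gt_zero_pi) auto
      then have "((\<lambda>\<alpha>. - (cos \<alpha> powr (2 * b + 2))) has_real_derivative ?\<rho> \<alpha>) (at \<alpha>)"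
        by (auto intro!: derivative_eq_intros simp: powr_diff field_simps powr_add power2_eq_square)
      then show "((\<lambda>\<alpha>. - (cos \<alpha> powr (2 * b + 2))) has_vector_derivative ?\<rho> \<alpha>) (at \<alpha>)"
        by (simp add: has_real_derivative_iff_has_vector_derivative)
    qed (use \<tau> in simp)
  qed
  also have "- (cos (pi / 2) powr (2 * b + 2)) - - (cos \<tau> powr (2 * b + 2)) = (1 + t / b) powr (- b - 1)"
  proof -
    have pos: "1 + t / b > 0"
      using assms by (intro add_pos_nonneg) auto
    have "cos \<tau> = (1 + t / b) powr (- 1 / 2)"
      using assms pos by (simp add: \<tau>_def cos_arctan powr_half_sqrt powr_minus_divide)
    moreover have "- 1 / 2 * (2 * b + 2) = - b - 1"
      by (simp add: add_divide_distrib)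
    ultimately have "cos \<tau> powr (2 * b + 2) = (1 + t / b) powr (- b - 1)"
      by (simp only: powr_powr)
    then show ?thesis by simp
  qed
  finally show ?thesis .
qed

text \<open>With \<open>P = sin \<alpha> * cos \<gamma>\<close> and \<open>Q = cos \<alpha> * sin \<gamma>\<close> the left-hand side is
  \<open>P * Q * (P\<^sup>2 + Q\<^sup>2)\<close> times \<open>(cos \<alpha> * cos \<gamma>) powr (2 * b - 2)\<close>, and \<open>P + Q = sin (2 * m)\<close>. The first
  factor is at most \<open>(P + Q) ^ 4 / 8\<close>, the difference being \<open>(P - Q) ^ 4 / 8\<close>. The second is at most
  \<open>((cos m)\<^sup>2) powr (2 * b - 2)\<close> by log-concavity of the cosine; here the exponent has to be
  nonnegative, that is, \<open>b \<ge> 1\<close>.\<close>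

lemma trig_mean_inequality:
  fixes b :: real
  assumes "1 \<le> b" "\<alpha> \<in> {0<..<pi / 2}" "\<gamma> \<in> {0<..<pi / 2}"
  defines "m \<equiv> (\<alpha> + \<gamma>) / 2"
  shows "((tan \<alpha>)\<^sup>2 + (tan \<gamma>)\<^sup>2) * ((sin \<alpha> * cos \<alpha> powr (2 * b + 1)) * (sin \<gamma> * cos \<gamma> powr (2 * b + 1)))
    \<le> 2 * (tan m)\<^sup>2 * (sin m * cos m powr (2 * b + 1))\<^sup>2"
proof -
  define P where "P = sin \<alpha> * cos \<gamma>"
  define Q where "Q = cos \<alpha> * sin \<gamma>"
  have trig: "0 < cos x" "0 < sin x" if "x \<in> {0<..<pi / 2}" for x
    using that by (auto intro!: cos_gt_zero_pi sin_gt_zero)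
  have "m \<in> {0<..<pi / 2}"
    using assms by (auto simp: m_def)
  note m = trig[OF this] and a = trig[OF assms(2)] and g = trig[OF assms(3)]
  have powr_split: "cos x powr (2 * b + 1) = cos x ^ 3 * cos x powr (2 * b - 2)" if "0 < cos x" for x
  proof -
    have "cos x powr (2 * b + 1) = cos x powr (3 + (2 * b - 2))"
      by (simp add: algebra_simps)
    also have "\<dots> = cos x powr 3 * cos x powr (2 * b - 2)" by (rule powr_add)
    also have "cos x powr 3 = cos x ^ 3"
      using that by (simp add: powr_numeral)
    finally show ?thesis .
  qed
  have double: "\<alpha> + \<gamma> = 2 * m"
    by (simp add: m_def)
  have cos_mean: "cos \<alpha> * cos \<gamma> \<le> (cos m)\<^sup>2"
  proof -
    have "2 * (cos m)\<^sup>2 = 1 + cos (\<alpha> + \<gamma>)"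
      unfolding double cos_double_cos by simp
    moreover have "cos (\<alpha> - \<gamma>) \<le> 1" by simp
    ultimately show ?thesis
      by (simp add: cos_add cos_diff)
  qed
  have sin_mean: "P + Q = 2 * (sin m * cos m)"
    using sin_double[of m] unfolding P_def Q_def double[symmetric] by (simp add: sin_add)
  have quartic: "8 * (P * Q * (P\<^sup>2 + Q\<^sup>2)) \<le> (P + Q) ^ 4"
  proof -
    have "(P + Q) ^ 4 - 8 * (P * Q * (P\<^sup>2 + Q\<^sup>2)) = (P - Q) ^ 4"
      by (simp add: power4_eq_xxxx power2_eq_square algebra_simps)
    moreover have "0 \<le> (P - Q) ^ 4" by simp
    ultimately show ?thesis by linarith
  qed
  have "((tan \<alpha>)\<^sup>2 + (tan \<gamma>)\<^sup>2) * ((sin \<alpha> * cos \<alpha> powr (2 * b + 1)) * (sin \<gamma> * cos \<gamma> powr (2 * b + 1)))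
      = (P * Q * (P\<^sup>2 + Q\<^sup>2)) * (cos \<alpha> * cos \<gamma>) powr (2 * b - 2)"
  proof -
    have algebra: "((sa / ca)\<^sup>2 + (sg / cg)\<^sup>2) * ((sa * (ca ^ 3 * A)) * (sg * (cg ^ 3 * C)))
        = (sa * cg * (ca * sg) * ((sa * cg)\<^sup>2 + (ca * sg)\<^sup>2)) * (A * C)"
      if "0 < ca" "0 < cg" for sa ca sg cg A C :: real
      using that by (simp add: field_simps power2_eq_square power3_eq_cube)
    have "(cos \<alpha> * cos \<gamma>) powr (2 * b - 2) = cos \<alpha> powr (2 * b - 2) * cos \<gamma> powr (2 * b - 2)"
      using a g by (simp add: powr_mult)
    then show ?thesis
      unfolding powr_split[OF a(1)] powr_split[OF g(1)] P_def Q_def tan_def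
      by (simp only: algebra[OF a(1) g(1)])
  qed
  also have "\<dots> \<le> ((P + Q) ^ 4 / 8) * ((cos m)\<^sup>2) powr (2 * b - 2)"
    using quartic cos_mean a g assms(1) by (intro mult_mono powr_mono2) auto
  also have "\<dots> = 2 * (sin m * cos m) ^ 4 * (cos m powr (2 * b - 2))\<^sup>2"
    using m by (simp add: sin_mean power_mult_distrib powr_mult power2_eq_square)
  also have "\<dots> = 2 * (tan m)\<^sup>2 * (sin m * cos m powr (2 * b + 1))\<^sup>2"
    unfolding powr_split[OF m(1)] tan_def
    using m by (simp add: field_simps power2_eq_square power3_eq_cube power4_eq_xxxx)
  finally show ?thesis .
qed

text \<open>The substitution \<open>\<theta> = b * (tan \<alpha>)\<^sup>2\<close> turns the weight \<open>(1 + \<theta> / b) powr (- b - 1)\<close> into a power of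
  \<open>cos \<alpha>\<close>. For \<open>b = 1\<close> the volume of \<open>q\<close> is then, up to a constant, the area of an
  ellipse whose boundary is parametrized by the angle \<open>2 * \<alpha>\<close>.\<close>

lemma level_parametrization_finite:
  fixes b :: real
  assumes "1 \<le> b"
  shows "level_parametrization (ereal b) {0<..<pi / 2} (\<lambda>\<alpha>. b * (tan \<alpha>)\<^sup>2)
           (\<lambda>\<alpha>. (2 * b + 2) * (sin \<alpha> * cos \<alpha> powr (2 * b + 1)))"
proof
  have cos: "0 < cos \<alpha>" and sin: "0 < sin \<alpha>" and tan: "0 < tan \<alpha>" if "\<alpha> \<in> {0<..<pi / 2}" for \<alpha>
    using that by (auto intro!: cos_gt_zero_pi sin_gt_zero tan_gt_zero)
  show "continuous_on {0<..<pi / 2} (\<lambda>\<alpha>. b * (tan \<alpha>)\<^sup>2)"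
    using cos by (intro continuous_intros) (auto simp: less_imp_neq[THEN not_sym])
  show "continuous_on {0<..<pi / 2} (\<lambda>\<alpha>. (2 * b + 2) * (sin \<alpha> * cos \<alpha> powr (2 * b + 1)))"
    using cos by (intro continuous_intros) (auto simp: less_imp_neq[THEN not_sym])
  show "0 < b * (tan \<alpha>)\<^sup>2" "0 < (2 * b + 2) * (sin \<alpha> * cos \<alpha> powr (2 * b + 1))"
    if "\<alpha> \<in> {0<..<pi / 2}" for \<alpha>
    using cos[OF that] sin[OF that] tan[OF that] assms by auto
  show "\<exists>\<alpha>\<in>{0<..<pi / 2}. b * (tan \<alpha>)\<^sup>2 = a" if "0 < a" for a
    using assms that arctan_ubound[of "sqrt (a / b)"]
    by (intro bexI[of _ "arctan (sqrt (a / b))"]) (auto simp: tan_arctan)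
  show "(\<integral>\<^sup>+ \<alpha>. ennreal ((2 * b + 2) * (sin \<alpha> * cos \<alpha> powr (2 * b + 1)))
            * indicator {\<alpha> \<in> {0<..<pi / 2}. t \<le> b * (tan \<alpha>)\<^sup>2} \<alpha> \<partial>lborel)
      = ennreal (weight (ereal b) (ereal t))" if "0 \<le> t" for t
    using weight_trig_integral[of b t] assms that by (simp add: weight_def)
  fix \<alpha> \<gamma> :: real
  assume in_S: "\<alpha> \<in> {0<..<pi / 2}" "\<gamma> \<in> {0<..<pi / 2}"
  let ?d = "\<lambda>\<alpha>. sin \<alpha> * cos \<alpha> powr (2 * b + 1)"
  have "(b * (2 * b + 2)\<^sup>2) * (((tan \<alpha>)\<^sup>2 + (tan \<gamma>)\<^sup>2) * (?d \<alpha> * ?d \<gamma>))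
      \<le> (b * (2 * b + 2)\<^sup>2) * (2 * (tan ((\<alpha> + \<gamma>) / 2))\<^sup>2 * (?d ((\<alpha> + \<gamma>) / 2))\<^sup>2)"
    using trig_mean_inequality[OF assms in_S] assms by (intro mult_left_mono) auto
  then show "(b * (tan \<alpha>)\<^sup>2 + b * (tan \<gamma>)\<^sup>2) * ((2 * b + 2) * ?d \<alpha> * ((2 * b + 2) * ?d \<gamma>))
      \<le> 2 * (b * (tan ((\<alpha> + \<gamma>) / 2))\<^sup>2) * ((2 * b + 2) * ?d ((\<alpha> + \<gamma>) / 2))\<^sup>2"
    by (simp only: power2_eq_square distrib_left[of b, symmetric] mult_ac)
qed (use pi_gt_zero in \<open>auto simp: is_interval_oo not_le\<close>)

section \<open>The quadratic\<close>

lemma nn_integral_gaussian: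
  assumes "0 < a"
  shows "(\<integral>\<^sup>+ x. ennreal (exp (- (a * x\<^sup>2))) \<partial>lborel) = ennreal (sqrt (pi / a))"
proof -
  define \<sigma> where "\<sigma> = sqrt (1 / (2 * a))"
  have \<sigma>: "0 < \<sigma>" "\<sigma>\<^sup>2 = 1 / (2 * a)"
    using assms by (simp_all add: \<sigma>_def)
  have "exp (- (a * x\<^sup>2)) = sqrt (pi / a) * normal_density 0 \<sigma> x" for x
    using assms by (simp add: normal_density_def \<sigma>(2) mult.commute)
  then have "(\<integral>\<^sup>+ x. ennreal (exp (- (a * x\<^sup>2))) \<partial>lborel)
      = ennreal (sqrt (pi / a)) * (\<integral>\<^sup>+ x. ennreal (normal_density 0 \<sigma> x) \<partial>lborel)"
    using assms by (simp add: ennreal_mult nn_integral_cmult)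
  also have "(\<integral>\<^sup>+ x. ennreal (normal_density 0 \<sigma> x) \<partial>lborel) = ennreal 1"
    using integral_normal_density[OF \<sigma>(1), of 0] integrable_normal_density[OF \<sigma>(1), of 0] \<sigma>(1)
    by (subst nn_integral_eq_integral) auto
  finally show ?thesis by simp
qed

lemma nn_integral_Gamma_scaled:
  assumes "0 < z" "0 < c"
  shows "(\<integral>\<^sup>+ s. ennreal (indicator {0..} s * s powr (z - 1) * exp (- (c * s))) \<partial>lborel)
    = ennreal (Gamma z * c powr (- z))"
proof -
  let ?f = "\<lambda>s::real. indicator {0..} s * s powr (z - 1) * exp (- (c * s))"
  have "ennreal (Gamma z) = (\<integral>\<^sup>+ t. ennreal (indicator {0..} t * t powr (z - 1) / exp t) \<partial>lborel)"
    by (rule Gamma_conv_nn_integral_real[OF assms(1)])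
  also have "\<dots> = \<bar>c\<bar> * (\<integral>\<^sup>+ s. ennreal (indicator {0..} (0 + c * s) * (0 + c * s) powr (z - 1) / exp (0 + c * s)) \<partial>lborel)"
    using assms by (intro nn_integral_real_affine) auto
  also have "(\<lambda>s. indicator {0..} (0 + c * s) * (0 + c * s) powr (z - 1) / exp (0 + c * s))
      = (\<lambda>s. c powr (z - 1) * ?f s)"
    using assms by (auto simp: fun_eq_iff indicator_def zero_le_mult_iff powr_mult exp_minus field_simps)
  also have "(\<integral>\<^sup>+ s. ennreal (c powr (z - 1) * ?f s) \<partial>lborel)
      = ennreal (c powr (z - 1)) * (\<integral>\<^sup>+ s. ennreal (?f s) \<partial>lborel)"
    by (subst nn_integral_cmult[symmetric]) (auto simp: ennreal_mult)
  finally have "ennreal (Gamma z) = ennreal (c * c powr (z - 1)) * (\<integral>\<^sup>+ s. ennreal (?f s) \<partial>lborel)"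
    using assms by (simp add: ennreal_mult mult.assoc)
  also have "c * c powr (z - 1) = c powr z"
    using assms by (simp add: powr_mult_base)
  finally have "ennreal (c powr (- z)) * ennreal (Gamma z)
      = ennreal (c powr (- z)) * (ennreal (c powr z) * (\<integral>\<^sup>+ s. ennreal (?f s) \<partial>lborel))"
    by simp
  also have "\<dots> = ennreal (c powr (- z) * c powr z) * (\<integral>\<^sup>+ s. ennreal (?f s) \<partial>lborel)"
    by (simp add: ennreal_mult mult.assoc)
  also have "c powr (- z) * c powr z = 1"
    using assms by (simp flip: powr_add)
  finally show ?thesis
    using assms by (simp add: mult.commute Gamma_real_pos less_imp_le flip: ennreal_mult)
qed

text \<open>Writing \<open>Gamma (b + 1) * (1 + t) powr (- b - 1)\<close> as the integral of \<open>s powr b * exp (- (1 + t) * s)\<close>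
  over \<open>s > 0\<close> and integrating over \<open>x\<close> first leaves a Gaussian integral, which contributes
  \<open>sqrt (2 * b * pi / s)\<close>, and then the integral of \<open>Gamma (b + 1 / 2)\<close>.\<close>

lemma V_q_finite:
  assumes "0 < b"
  shows "V (ereal b) q = ennreal (sqrt (2 * b * pi) * (Gamma (b + 1 / 2) / Gamma (b + 1)))"
proof -
  let ?g = "\<lambda>s x. ennreal (indicator {0..} s * s powr b * exp (- ((1 + x\<^sup>2 / (2 * b)) * s)))"
  have \<Gamma>: "0 < Gamma (b + 1)" "0 < Gamma (b + 1 / 2)"
    using assms by (auto intro: Gamma_real_pos)
  have inner_s: "ennreal (Gamma (b + 1)) * ennreal (weight (ereal b) (q x)) = (\<integral>\<^sup>+ s. ?g s x \<partial>lborel)" for x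
  proof -
    have pos: "0 < 1 + x\<^sup>2 / (2 * b)"
      using assms by (intro add_pos_nonneg) auto
    have "(\<integral>\<^sup>+ s. ?g s x \<partial>lborel) = ennreal (Gamma (b + 1) * (1 + x\<^sup>2 / (2 * b)) powr (- (b + 1)))"
      using nn_integral_Gamma_scaled[of "b + 1", OF _ pos] assms by simp
    then show ?thesis
      using \<Gamma> by (simp add: weight_def q_def ennreal_mult)
  qed
  have inner_x: "(\<integral>\<^sup>+ x. ?g s x \<partial>lborel)
      = ennreal (sqrt (2 * b * pi)) * ennreal (indicator {0..} s * s powr (b + 1 / 2 - 1) * exp (- (1 * s)))" for s
  proof (cases "0 < s")
    case True
    have "?g s x = ennreal (s powr b * exp (- s)) * ennreal (exp (- (s / (2 * b) * x\<^sup>2)))" for x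
      using True by (simp add: ring_distribs exp_add exp_diff exp_minus field_simps flip: ennreal_mult)
    then have "(\<integral>\<^sup>+ x. ?g s x \<partial>lborel)
        = ennreal (s powr b * exp (- s)) * ennreal (sqrt (pi / (s / (2 * b))))"
      using nn_integral_gaussian[of "s / (2 * b)"] True assms by (simp add: nn_integral_cmult)
    also have "\<dots> = ennreal (s powr b * exp (- s) * sqrt (pi / (s / (2 * b))))"
      using True assms by (simp add: ennreal_mult)
    also have "s powr b * exp (- s) * sqrt (pi / (s / (2 * b)))
        = sqrt (2 * b * pi) * (indicator {0..} s * s powr (b + 1 / 2 - 1) * exp (- (1 * s)))"
    proof -
      have "sqrt (pi / (s / (2 * b))) = sqrt (2 * b * pi) * s powr (- (1 / 2))"
      proof -
        have "pi / (s / (2 * b)) = 2 * b * pi / s" by simp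
        then have "sqrt (pi / (s / (2 * b))) = sqrt (2 * b * pi) / sqrt s"
          by (simp only: real_sqrt_divide)
        also have "sqrt s = s powr (1 / 2)"
          using True by (simp add: powr_half_sqrt)
        finally show ?thesis
          by (simp only: powr_minus divide_inverse)
      qed
      moreover have "s powr (b + 1 / 2 - 1) = s powr b * s powr (- (1 / 2))"
        by (simp flip: powr_add)
      ultimately show ?thesis
        using True by simp
    qed
    finally show ?thesis
      using True assms by (simp add: ennreal_mult)
  qed (auto simp: indicator_def)
  have "ennreal (Gamma (b + 1)) * V (ereal b) q
      = (\<integral>\<^sup>+ x. ennreal (Gamma (b + 1)) * ennreal (weight (ereal b) (q x)) \<partial>lborel)"
    unfolding V_def by (subst nn_integral_cmult) (auto simp: weight_def q_def)
  also have "\<dots> = (\<integral>\<^sup>+ x. \<integral>\<^sup>+ s. ?g s x \<partial>lborel \<partial>lborel)"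
    by (simp only: inner_s)
  also have "\<dots> = (\<integral>\<^sup>+ s. \<integral>\<^sup>+ x. ?g s x \<partial>lborel \<partial>lborel)"
    by (rule lborel_pair.Fubini') measurable
  also have "\<dots> = (\<integral>\<^sup>+ s. ennreal (sqrt (2 * b * pi))
      * ennreal (indicator {0..} s * s powr (b + 1 / 2 - 1) * exp (- (1 * s))) \<partial>lborel)"
    by (simp only: inner_x)
  also have "\<dots> = ennreal (sqrt (2 * b * pi)) * ennreal (Gamma (b + 1 / 2))"
    using nn_integral_Gamma_scaled[of "b + 1 / 2" 1] assms
    by (subst nn_integral_cmult) auto
  finally have eq: "ennreal (Gamma (b + 1)) * V (ereal b) q
      = ennreal (sqrt (2 * b * pi)) * ennreal (Gamma (b + 1 / 2))" .
  have "V (ereal b) q = ennreal (inverse (Gamma (b + 1)) * Gamma (b + 1)) * V (ereal b) q"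
    using \<Gamma> by simp
  also have "\<dots> = ennreal (inverse (Gamma (b + 1))) * (ennreal (Gamma (b + 1)) * V (ereal b) q)"
    using \<Gamma> by (subst ennreal_mult) (auto simp: mult.assoc)
  also have "\<dots> = ennreal (inverse (Gamma (b + 1)) * (sqrt (2 * b * pi) * Gamma (b + 1 / 2)))"
    unfolding eq using \<Gamma> assms by (simp add: ennreal_mult less_imp_le)
  also have "inverse (Gamma (b + 1)) * (sqrt (2 * b * pi) * Gamma (b + 1 / 2))
      = sqrt (2 * b * pi) * (Gamma (b + 1 / 2) / Gamma (b + 1))"
    by (simp only: divide_inverse mult_ac)
  finally show ?thesis .
qed

lemma V_q_infinite: "V \<infinity> q = ennreal (sqrt (2 * pi))"
  using nn_integral_gaussian[of "1 / 2"] by (simp add: V_def weight_def q_def mult.commute)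

lemma V_quadratic_scale:
  assumes "0 < c"
  shows "V \<beta> q = ennreal (sqrt c) * V \<beta> (\<lambda>x. ereal (c * x\<^sup>2 / 2))"
proof -
  have [measurable]: "(\<lambda>x. weight \<beta> (q x)) \<in> borel_measurable borel"
    unfolding weight_def q_def by measurable
  have "V \<beta> q = \<bar>sqrt c\<bar> * (\<integral>\<^sup>+ x. ennreal (weight \<beta> (q (0 + sqrt c * x))) \<partial>lborel)"
    unfolding V_def using assms by (intro nn_integral_real_affine) auto
  also have "\<dots> = ennreal (sqrt c) * V \<beta> (\<lambda>x. ereal (c * x\<^sup>2 / 2))"
    using assms by (simp add: V_def q_def power_mult_distrib)
  finally show ?thesis .
qed

lemma legendre_quadratic:
  assumes "0 < c"
  shows "legendre (\<lambda>x. ereal (c * x\<^sup>2 / 2)) y = ereal (1 / c * y\<^sup>2 / 2)"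
proof (rule antisym)
  show "legendre (\<lambda>x. ereal (c * x\<^sup>2 / 2)) y \<le> ereal (1 / c * y\<^sup>2 / 2)"
    unfolding legendre_def
  proof (rule SUP_least)
    fix x
    have "1 / c * y\<^sup>2 / 2 - (x * y - c * x\<^sup>2 / 2) = (c * x - y)\<^sup>2 / (2 * c)"
      using assms by (simp add: field_simps power2_eq_square)
    moreover have "0 \<le> (c * x - y)\<^sup>2 / (2 * c)"
      using assms by simp
    ultimately have "x * y - c * x\<^sup>2 / 2 \<le> 1 / c * y\<^sup>2 / 2" by linarith
    then show "ereal (x * y) - ereal (c * x\<^sup>2 / 2) \<le> ereal (1 / c * y\<^sup>2 / 2)"
      by simp
  qed
  have "ereal (1 / c * y\<^sup>2 / 2) = ereal (y / c * y) - ereal (c * (y / c)\<^sup>2 / 2)"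
    using assms by (simp add: field_simps power2_eq_square)
  also have "\<dots> \<le> legendre (\<lambda>x. ereal (c * x\<^sup>2 / 2)) y"
    by (rule legendre_ge)
  finally show "ereal (1 / c * y\<^sup>2 / 2) \<le> legendre (\<lambda>x. ereal (c * x\<^sup>2 / 2)) y" .
qed

text \<open>The Legendre transform replaces \<open>c\<close> by \<open>1 / c\<close>, and the dilations of the two volumes cancel.\<close>

lemma V_product_quadratic:
  assumes "0 < c" "\<And>x. \<phi> x = ereal (c * x\<^sup>2 / 2)"
  shows "V \<beta> \<phi> * V \<beta> (legendre \<phi>) = (V \<beta> q)\<^sup>2"
proof -
  have \<phi>: "\<phi> = (\<lambda>x. ereal (c * x\<^sup>2 / 2))"
    using assms(2) by (rule ext)
  have L: "legendre \<phi> = (\<lambda>y. ereal (1 / c * y\<^sup>2 / 2))"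
    unfolding \<phi> using legendre_quadratic[OF assms(1)] by (rule ext)
  have "V \<beta> q = ennreal (sqrt c) * V \<beta> \<phi>"
    unfolding \<phi> by (rule V_quadratic_scale[OF assms(1)])
  moreover have "V \<beta> q = ennreal (sqrt (1 / c)) * V \<beta> (legendre \<phi>)"
    unfolding L using assms(1) by (intro V_quadratic_scale) simp
  ultimately have "(V \<beta> q)\<^sup>2 = (ennreal (sqrt c) * V \<beta> \<phi>) * (ennreal (sqrt (1 / c)) * V \<beta> (legendre \<phi>))"
    unfolding power2_eq_square by metis
  also have "\<dots> = ennreal (sqrt c * sqrt (1 / c)) * (V \<beta> \<phi> * V \<beta> (legendre \<phi>))"
    using assms(1) by (subst ennreal_mult) (auto simp: mult_ac)
  also have "sqrt c * sqrt (1 / c) = 1"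
    using assms(1) by (simp flip: real_sqrt_mult)
  finally show ?thesis by simp
qed

section \<open>The inequality for \<open>1 \<le> \<beta> \<le> \<infinity>\<close>\<close>

theorem theorem2p6:
  fixes \<beta> :: ereal
  assumes "1 \<le> \<beta>"
  shows "(\<forall>\<phi> :: real \<Rightarrow> ereal.
            (\<forall>x. 0 \<le> \<phi> x) \<and> proper_fun \<phi> \<and> lower_semicont \<phi> \<and> even_fun \<phi> \<and> convex_fun \<phi> \<and> \<phi> 0 = 0 \<and>
            0 < V \<beta> \<phi> \<and> V \<beta> \<phi> < \<infinity> \<and> 0 < V \<beta> (legendre \<phi>) \<and> V \<beta> (legendre \<phi>) < \<infinity> \<longrightarrow>
            V \<beta> \<phi> * V \<beta> (legendre \<phi>) \<le> (V \<beta> q)\<^sup>2 \<and>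
            (V \<beta> \<phi> * V \<beta> (legendre \<phi>) = (V \<beta> q)\<^sup>2 \<longleftrightarrow>
               (\<exists>c>0. \<forall>x. \<phi> x = ereal (c * x\<^sup>2 / 2)))) \<and>
         (\<forall>b :: real. \<beta> = ereal b \<longrightarrow>
            (V \<beta> q)\<^sup>2 = ennreal (2 * b * pi * (Gamma (b + 1 / 2) / Gamma (b + 1))\<^sup>2)) \<and>
         (\<beta> = \<infinity> \<longrightarrow> (V \<beta> q)\<^sup>2 = ennreal (2 * pi))"
proof (intro conjI allI impI)
  fix \<phi> :: "real \<Rightarrow> ereal"
  assume A: "(\<forall>x. 0 \<le> \<phi> x) \<and> proper_fun \<phi> \<and> lower_semicont \<phi> \<and> even_fun \<phi> \<and> convex_fun \<phi> \<and> \<phi> 0 = 0 \<and>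
      0 < V \<beta> \<phi> \<and> V \<beta> \<phi> < \<infinity> \<and> 0 < V \<beta> (legendre \<phi>) \<and> V \<beta> (legendre \<phi>) < \<infinity>"
  then have g: "even_convex \<phi>"
    by (simp add: even_convex_def)
  have profiles: "profile \<phi>" "profile (legendre \<phi>)"
    using profile_of_V[OF assms] A g even_convex_legendre[OF g] by auto
  have q_finite: "V \<beta> q < \<infinity>"
    using assms by (cases \<beta>) (auto simp: V_q_finite V_q_infinite one_ereal_def)
  obtain S \<theta> \<rho> where "level_parametrization \<beta> S \<theta> \<rho>"
    using assms level_parametrization_finite level_parametrization_infinite
    by (cases \<beta>) (auto simp: one_ereal_def)
  then interpret level_parametrization \<beta> S \<theta> \<rho> .
  show "V \<beta> \<phi> * V \<beta> (legendre \<phi>) \<le> (V \<beta> q)\<^sup>2"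
    using santalo_inequality(1)[OF profiles] A q_finite by blast
  show "V \<beta> \<phi> * V \<beta> (legendre \<phi>) = (V \<beta> q)\<^sup>2 \<longleftrightarrow> (\<exists>c>0. \<forall>x. \<phi> x = ereal (c * x\<^sup>2 / 2))"
    using santalo_inequality(2)[OF profiles] A q_finite V_product_quadratic by blast
next
  fix b :: real
  assume b: "\<beta> = ereal b"
  then have "1 \<le> b"
    using assms by (simp add: one_ereal_def)
  then have "0 \<le> sqrt (2 * b * pi) * (Gamma (b + 1 / 2) / Gamma (b + 1))"
    by (intro mult_nonneg_nonneg divide_nonneg_nonneg less_imp_le[OF Gamma_real_pos]) auto
  then show "(V \<beta> q)\<^sup>2 = ennreal (2 * b * pi * (Gamma (b + 1 / 2) / Gamma (b + 1))\<^sup>2)"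
    using \<open>1 \<le> b\<close>
    by (simp add: b V_q_finite ennreal_power power_mult_distrib power_divide)
next
  assume "\<beta> = \<infinity>"
  then show "(V \<beta> q)\<^sup>2 = ennreal (2 * pi)"
    by (simp add: V_q_infinite ennreal_power)
qed

end
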